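(* Let $\alpha>0$ be a constant independent of $n$, let $m=\alpha n$, and let $H$ be an $m\times n$ matrix with i.i.d. standard normal components. Let $$\xi_p=\max_{x\in\{-\frac{1}{\sqrt n},\frac{1}{\sqrt n}\}^n,\ y\in\{-\frac{1}{\sqrt m},\frac{1}{\sqrt m}\}^m} y^T H x .$$ Let $\xi_{SK}$ be the average ground state energy of the Sherrington-Kirkpatrick model in the thermodynamic limit (defined in the context). Let $\epsilon_1^{(m_{sk})},\epsilon_1^{(n_{sk})}\in(0,1)$ be arbitrarily small constants independent of $n$, and let $\xi_p^{(l)}$ be the scalar such that $$\frac{\xi_p^{(l)}}{\sqrt n}=(1-\epsilon_1^{(m_{sk})})\sqrt{\alpha}\,\xi_{SK}+(1-\epsilon_1^{(n_{sk})})\,\xi_{SK}.$$ Then $$\lim_{n\to\infty}P(\xi_p\ge \xi_p^{(l)})=1,\qquad\text{equivalently}\qquad \lim_{n\to\infty}P\big(\xi_p^2\ge (\xi_p^{(l)})^2\big)=1,$$ and $$\liminf_{n\to\infty}\frac{E\xi_p}{\sqrt n}\ \ge\ (\sqrt{\alpha}+1)\,\xi_{SK}.$$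
   Context: The constant $\xi_{SK}$ is defined by $$\xi_{SK}=\lim_{n\to\infty}\frac{E\big(\max_{x\in\{-\frac{1}{\sqrt n},\frac{1}{\sqrt n}\}^n} x^T H^{(2)} x\big)}{\sqrt{2n}},$$ where $H^{(2)}$ is an $n\times n$ matrix with i.i.d. standard normal components (the limit exists by known results on the Sherrington-Kirkpatrick model; numerically $\xi_{SK}\approx 0.763$). The limits are taken along positive integers $n$ for which $m=\alpha n$ is an integer. $P$ and $E$ denote probability and expectation. *)

theory Defs
  imports "HOL-Probability.Probability"
begin

text \<open>Vectors in \<open>\<real>^n\<close> are functions \<open>nat \<Rightarrow> real\<close> used on the indices \<open>{..<n}\<close>, and an
  \<open>m \<times> n\<close> matrix is a function \<open>nat \<Rightarrow> nat \<Rightarrow> real\<close> used on \<open>{..<m} \<times> {..<n}\<close>, because the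
  dimensions vary inside the limits below.\<close>

definition sign_vectors :: "nat \<Rightarrow> (nat \<Rightarrow> real) set" where
  "sign_vectors n = {..<n} \<rightarrow>\<^sub>E {- 1 / sqrt (real n), 1 / sqrt (real n)}"

definition bilin :: "nat \<Rightarrow> nat \<Rightarrow> (nat \<Rightarrow> nat \<Rightarrow> real) \<Rightarrow> (nat \<Rightarrow> real) \<Rightarrow> (nat \<Rightarrow> real) \<Rightarrow> real" where
  "bilin m n A y x = (\<Sum>i<m. \<Sum>j<n. y i * A i j * x j)"

definition xi_max :: "nat \<Rightarrow> nat \<Rightarrow> (nat \<Rightarrow> nat \<Rightarrow> real) \<Rightarrow> real" where
  "xi_max m n A = Max {bilin m n A y x | x y. x \<in> sign_vectors n \<and> y \<in> sign_vectors m}"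

definition sk_max :: "nat \<Rightarrow> (nat \<Rightarrow> nat \<Rightarrow> real) \<Rightarrow> real" where
  "sk_max n A = Max {bilin n n A x x | x. x \<in> sign_vectors n}"

definition iid_std_normal_matrix ::
  "'a measure \<Rightarrow> nat \<Rightarrow> nat \<Rightarrow> ('a \<Rightarrow> nat \<Rightarrow> nat \<Rightarrow> real) \<Rightarrow> bool" where
  "iid_std_normal_matrix M m n H \<longleftrightarrow>
     prob_space.indep_vars M (\<lambda>_. borel) (\<lambda>(i, j) \<omega>. H \<omega> i j) ({..<m} \<times> {..<n}) \<and>
     (\<forall>i<m. \<forall>j<n. distributed M lborel (\<lambda>\<omega>. H \<omega> i j) std_normal_density)"

definition gaussian_matrix_measure :: "nat \<Rightarrow> nat \<Rightarrow> (nat \<times> nat \<Rightarrow> real) measure" where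
  "gaussian_matrix_measure m n = PiM ({..<m} \<times> {..<n}) (\<lambda>_. std_normal_distribution)"

lemma prob_space_gaussian_matrix_measure: "prob_space (gaussian_matrix_measure m n)"
  unfolding gaussian_matrix_measure_def
  by (intro prob_space_PiM prob_space_normal_density) simp

lemma iid_std_normal_matrix_gaussian_matrix_measure:
  "iid_std_normal_matrix (gaussian_matrix_measure m n) m n curry"
proof -
  let ?I = "{..<m} \<times> {..<n}"
  let ?N = "\<lambda>_ :: nat \<times> nat. std_normal_distribution"
  have N: "\<And>i. prob_space (?N i)" by (intro prob_space_normal_density) simp
  interpret P: prob_space "PiM ?I ?N" by (intro prob_space_PiM N)
  have d: "distr (PiM ?I ?N) lborel (\<lambda>\<omega>. \<omega> p) = std_normal_distribution" if "p \<in> ?I" for p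
  proof -
    have "distr (PiM ?I ?N) lborel (\<lambda>\<omega>. \<omega> p) = distr (PiM ?I ?N) (?N p) (\<lambda>\<omega>. \<omega> p)"
      by (intro distr_cong) auto
    also have "\<dots> = std_normal_distribution"
      using distr_PiM_component[of ?I ?N p] N that by auto
    finally show ?thesis .
  qed
  have "P.indep_vars ?N (\<lambda>p \<omega>. \<omega> p) ?I"
  proof (cases "?I = {}")
    case True
    show ?thesis
      unfolding P.indep_vars_def P.indep_sets_def using True by blast
  next
    case False
    have "distr (PiM ?I ?N) (PiM ?I ?N) (\<lambda>\<omega>. \<lambda>p\<in>?I. \<omega> p) = distr (PiM ?I ?N) (PiM ?I ?N) (\<lambda>\<omega>. \<omega>)"
      by (intro distr_cong) (auto simp: space_PiM)
    also have "\<dots> = PiM ?I (\<lambda>p. distr (PiM ?I ?N) (?N p) (\<lambda>\<omega>. \<omega> p))"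
      unfolding distr_id
      by (intro PiM_cong refl distr_PiM_component[symmetric] N) auto
    finally show ?thesis
      by (subst P.indep_vars_iff_distr_eq_PiM'[OF False]) (auto intro: measurable_component_singleton)
  qed
  then have "P.indep_vars (\<lambda>_. borel) (\<lambda>p \<omega>. \<omega> p) ?I"
    by (rule P.indep_vars_compose2[where Y = "\<lambda>_ x. x"]) auto
  then have "P.indep_vars (\<lambda>_. borel) (\<lambda>(i, j) \<omega>. curry \<omega> i j) ?I"
    by (simp add: case_prod_unfold)
  moreover have "distributed (PiM ?I ?N) lborel (\<lambda>\<omega>. curry \<omega> i j) std_normal_density"
    if "i < m" "j < n" for i j
    using d[of "(i, j)"] that by (auto simp: distributed_def curry_def)
  ultimately show ?thesis
    unfolding iid_std_normal_matrix_def gaussian_matrix_measure_def by blast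
qed

definition xi_SK :: real where
  "xi_SK = lim (\<lambda>n. (\<integral>A. sk_max n (curry A) \<partial>gaussian_matrix_measure n n) / sqrt (2 * real n))"

definition admissible :: "real \<Rightarrow> nat set" where
  "admissible \<alpha> = {n. 0 < n \<and> \<alpha> * real n \<in> \<nat>}"

text \<open>The limit \<open>n \<rightarrow> \<infinity>\<close> along the admissible \<open>n\<close>; this filter is \<open>bot\<close> exactly
  when \<open>admissible \<alpha>\<close> is finite, i.e. (for \<open>\<alpha> > 0\<close>) when \<open>\<alpha>\<close> is irrational.\<close>

definition admissible_at_top :: "real \<Rightarrow> nat filter" where
  "admissible_at_top \<alpha> = inf sequentially (principal (admissible \<alpha>))"

end

theory Submission
  imports Defs
begin

text \<open>Write \<open>P\<close> and \<open>Q\<close> for the overlaps of two choices of \<open>x\<close> and of \<open>y\<close>. The Gaussian process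
  \<open>y\<^sup>T H x\<close> has covariance \<open>P * Q\<close>, and \<open>(x\<^sup>T H\<^sub>1 x + y\<^sup>T H\<^sub>2 y) / sqrt 2\<close> has covariance
  \<open>(P\<^sup>2 + Q\<^sup>2) / 2\<close>, with equal variances. Since \<open>P * Q \<le> (P\<^sup>2 + Q\<^sup>2) / 2\<close>, Slepian's inequality bounds
  \<open>E \<xi>\<^sub>p\<close> from below by the two ground state energies. Slepian's inequality applied to the convex
  function \<open>q\<^sup>2\<close> of the overlap also makes \<open>sqrt n\<close> times the expected ground state superadditive, so
  that the limit defining \<open>xi_SK\<close> exists by Fekete's argument, and it is positive. Finally
  \<open>\<xi>\<^sub>p\<close> has variance at most \<open>1\<close>, and Chebyshev's inequality gives the probability statements.

  Slepian's inequality is obtained from small Gaussian steps of variance \<open>1 / N\<close>: one step changes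
  \<open>log-sum-exp\<close> by \<open>1 / (2 N)\<close> times a tilted variance, up to an error of order \<open>N powr (- 3 / 2)\<close>
  that is uniform in the starting point. Steps of the two processes commute, so the
  pointwise comparison of one step can be iterated \<open>N\<close> times with total error of order \<open>1 / sqrt N\<close>.\<close>

subsection \<open>Averages over Gaussian directions\<close>

text \<open>The classical proof of Slepian's inequality interpolates between the two processes and
  integrates by parts. Small steps replace this by a third-order Taylor bound and one-dimensional
  normal integrals. One step has to be compared at every starting point, because the other steps
  average over it; hence averages are operators on functions, and errors must be uniform.
  Log-sum-exp is suited to this: its first three derivatives along a direction are bounded through
  the size of that direction alone, wherever they are taken.

  The maximum fluctuates by a bounded amount only, so the probability statement needs a gap of order
  \<open>sqrt n\<close> between \<open>\<xi>\<^sub>l\<close> and the expected maximum. That gap is a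
  positive combination of the two epsilons times \<open>xi_SK\<close>, which is why positivity of
  \<open>xi_SK\<close> has to be proved. Positivity also makes \<open>\<xi>\<^sub>l\<close>
  nonnegative, on which the squared statement rests.\<close>

lemma prob_space_std_normal_distribution: "prob_space std_normal_distribution"
  by (rule prob_space_normal_density) simp

interpretation std_normal: prob_space std_normal_distribution
  by (rule prob_space_std_normal_distribution)

interpretation std_normal_pair: pair_prob_space std_normal_distribution std_normal_distribution
  by unfold_locales

interpretation std_normal_PiM: product_sigma_finite "\<lambda>_. std_normal_distribution"
  by unfold_locales

lemma measure_std_normal_UNIV [simp]: "measure std_normal_distribution UNIV = 1"
  using std_normal.prob_space by simp

lemma integrable_std_normal_abs_power [simp]:
  "integrable std_normal_distribution (\<lambda>x. \<bar>x\<bar> ^ k)"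
  using integrable_std_normal_moment_abs[of k] by (subst integrable_density) auto

lemma integrable_std_normal_abs [simp]: "integrable std_normal_distribution (\<lambda>x. \<bar>x\<bar>)"
  using integrable_std_normal_abs_power[of 1] by simp

lemma integrable_std_normal_power [simp]: "integrable std_normal_distribution (\<lambda>x. x ^ k)"
  by (rule integrable_std_normal_distribution_moment)

lemma integrable_std_normal_id [simp]: "integrable std_normal_distribution (\<lambda>x. x)"
  using integrable_std_normal_power[of 1] by simp

lemma integral_std_normal_id [simp]: "(\<integral>x. x \<partial>std_normal_distribution) = 0"
  using integral_std_normal_distribution_moment_odd[of 1] by simp

lemma integral_std_normal_square [simp]: "(\<integral>x. x\<^sup>2 \<partial>std_normal_distribution) = 1"
  using std_normal_distribution_even_moments(1)[of 1] by simp

lemma integral_std_normal_abs [simp]: "(\<integral>x. \<bar>x\<bar> \<partial>std_normal_distribution) = sqrt (2 / pi)"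
  using std_normal_distribution_odd_moments_abs[of 0] by simp

text \<open>One constant per coordinate, rather than one for a norm, because the variance bound adds
  up the squares of these constants. For finite \<open>S\<close> the condition makes
  \<open>F\<close> depend on the coordinates in \<open>S\<close> only. It gives at most linear
  growth, hence Gaussian integrability, and is inherited by averages.\<close>

definition lipschitz_coords :: "'s set \<Rightarrow> ('s \<Rightarrow> real) \<Rightarrow> (('s \<Rightarrow> real) \<Rightarrow> real) \<Rightarrow> bool" where
  "lipschitz_coords S c F \<longleftrightarrow> (\<forall>z w. \<bar>F z - F w\<bar> \<le> (\<Sum>s\<in>S. c s * \<bar>z s - w s\<bar>))"

lemma lipschitz_coordsD: "lipschitz_coords S c F \<Longrightarrow> \<bar>F z - F w\<bar> \<le> (\<Sum>s\<in>S. c s * \<bar>z s - w s\<bar>)"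
  by (simp add: lipschitz_coords_def)

lemma integrable_std_normal_lipschitz:
  fixes f :: "real \<Rightarrow> real"
  assumes "\<And>x y. \<bar>f x - f y\<bar> \<le> K * \<bar>x - y\<bar>"
  shows "integrable std_normal_distribution f"
proof -
  have "K \<ge> 0" using assms[of 0 1] by simp
  then have "K-lipschitz_on UNIV f"
    using assms by (intro lipschitz_onI) (auto simp: dist_real_def)
  then have "continuous_on UNIV f" by (rule lipschitz_on_continuous_on)
  then have "f \<in> borel_measurable std_normal_distribution"
    by (simp add: borel_measurable_continuous_onI)
  moreover have "norm (f x) \<le> norm (\<bar>f 0\<bar> + K * \<bar>x\<bar>)" for x
    using assms[of x 0] \<open>K \<ge> 0\<close> by (auto simp: abs_if split: if_splits)
  moreover have "integrable std_normal_distribution (\<lambda>x. \<bar>f 0\<bar> + K * \<bar>x\<bar>)"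
    by (intro Bochner_Integration.integrable_add integrable_mult_right) simp_all
  ultimately show ?thesis
    using Bochner_Integration.integrable_bound[OF _ _ AE_I2] by blast
qed

text \<open>The heat semigroup in the direction \<open>a\<close>, at time one. The starting point
  \<open>z\<close> stays an argument, so that averages can be composed.\<close>

definition gauss_avg :: "('s \<Rightarrow> real) \<Rightarrow> (('s \<Rightarrow> real) \<Rightarrow> real) \<Rightarrow> ('s \<Rightarrow> real) \<Rightarrow> real" where
  "gauss_avg a F z = (\<integral>x. F (\<lambda>s. z s + x * a s) \<partial>std_normal_distribution)"

lemma lipschitz_coords_line:
  assumes "lipschitz_coords S c F"
  shows "\<bar>F (\<lambda>s. z s + x * a s) - F (\<lambda>s. z s + y * a s)\<bar> \<le> (\<Sum>s\<in>S. c s * \<bar>a s\<bar>) * \<bar>x - y\<bar>"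
proof -
  have *: "\<bar>x * a s - y * a s\<bar> = \<bar>a s\<bar> * \<bar>x - y\<bar>" for s
    by (metis abs_mult mult.commute right_diff_distrib)
  show ?thesis
    using lipschitz_coordsD[OF assms, of "\<lambda>s. z s + x * a s" "\<lambda>s. z s + y * a s"]
    by (simp add: * sum_distrib_right mult.assoc)
qed

lemma integrable_gauss_avg:
  assumes "lipschitz_coords S c F"
  shows "integrable std_normal_distribution (\<lambda>x. F (\<lambda>s. z s + x * a s))"
  using lipschitz_coords_line[OF assms] by (rule integrable_std_normal_lipschitz)

lemma lipschitz_coords_gauss_avg:
  assumes "lipschitz_coords S c F"
  shows "lipschitz_coords S c (gauss_avg a F)"
  unfolding lipschitz_coords_def
proof (intro allI)
  fix z w
  have "\<bar>gauss_avg a F z - gauss_avg a F w\<bar>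
      = \<bar>\<integral>x. F (\<lambda>s. z s + x * a s) - F (\<lambda>s. w s + x * a s) \<partial>std_normal_distribution\<bar>"
    unfolding gauss_avg_def
    by (subst Bochner_Integration.integral_diff) (auto intro: integrable_gauss_avg[OF assms])
  also have "\<dots> \<le> (\<integral>x. \<bar>F (\<lambda>s. z s + x * a s) - F (\<lambda>s. w s + x * a s)\<bar> \<partial>std_normal_distribution)"
    by (rule integral_abs_bound)
  also have "\<dots> \<le> (\<integral>x. (\<Sum>s\<in>S. c s * \<bar>z s - w s\<bar>) \<partial>std_normal_distribution)"
  proof (rule integral_mono)
    fix x
    show "\<bar>F (\<lambda>s. z s + x * a s) - F (\<lambda>s. w s + x * a s)\<bar> \<le> (\<Sum>s\<in>S. c s * \<bar>z s - w s\<bar>)"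
      using lipschitz_coordsD[OF assms, of "\<lambda>s. z s + x * a s" "\<lambda>s. w s + x * a s"] by simp
  qed (intro integrable_abs Bochner_Integration.integrable_diff integrable_gauss_avg[OF assms] | simp)+
  finally show "\<bar>gauss_avg a F z - gauss_avg a F w\<bar> \<le> (\<Sum>s\<in>S. c s * \<bar>z s - w s\<bar>)"
    by simp
qed

lemma gauss_avg_mono:
  assumes "lipschitz_coords S c F" "lipschitz_coords S c G" "\<And>z. F z \<le> G z + e"
  shows "gauss_avg a F z \<le> gauss_avg a G z + e"
proof -
  have "gauss_avg a F z \<le> (\<integral>x. G (\<lambda>s. z s + x * a s) + e \<partial>std_normal_distribution)"
    unfolding gauss_avg_def using assms(3)
    by (intro integral_mono Bochner_Integration.integrable_add)
       (auto intro: integrable_gauss_avg[OF assms(1)] integrable_gauss_avg[OF assms(2)])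
  also have "\<dots> = gauss_avg a G z + e"
    unfolding gauss_avg_def
    by (subst Bochner_Integration.integral_add)
       (auto intro: integrable_gauss_avg[OF assms(2)])
  finally show ?thesis .
qed

text \<open>A Lipschitz function of \<open>(x, y)\<close> is continuous, hence jointly measurable,
  and grows at most linearly. This is the integrability that Fubini's theorem requires for
  exchanging two averages.\<close>

lemma integrable_lipschitz_coords_plane:
  assumes "lipschitz_coords S c F"
  shows "integrable (std_normal_distribution \<Otimes>\<^sub>M std_normal_distribution)
           (\<lambda>(x, y). F (\<lambda>s. z s + x * a s + y * b s))"
proof -
  define K where "K = (\<Sum>s\<in>S. \<bar>c s\<bar> * \<bar>a s\<bar>)"
  define L where "L = (\<Sum>s\<in>S. \<bar>c s\<bar> * \<bar>b s\<bar>)"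
  have lip: "\<bar>F (\<lambda>s. z s + x * a s + y * b s) - F (\<lambda>s. z s + x' * a s + y' * b s)\<bar>
      \<le> K * \<bar>x - x'\<bar> + L * \<bar>y - y'\<bar>" for x y x' y'
  proof -
    have "\<bar>F (\<lambda>s. z s + x * a s + y * b s) - F (\<lambda>s. z s + x' * a s + y' * b s)\<bar>
      \<le> (\<Sum>s\<in>S. c s * \<bar>(z s + x * a s + y * b s) - (z s + x' * a s + y' * b s)\<bar>)"
      by (rule lipschitz_coordsD[OF assms])
    also have "\<dots> \<le> (\<Sum>s\<in>S. \<bar>c s\<bar> * (\<bar>a s\<bar> * \<bar>x - x'\<bar> + \<bar>b s\<bar> * \<bar>y - y'\<bar>))"
    proof (intro sum_mono mult_mono)
      fix s
      have "(z s + x * a s + y * b s) - (z s + x' * a s + y' * b s) = a s * (x - x') + b s * (y - y')"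
        by (simp add: algebra_simps)
      then show "\<bar>(z s + x * a s + y * b s) - (z s + x' * a s + y' * b s)\<bar> \<le> \<bar>a s\<bar> * \<bar>x - x'\<bar> + \<bar>b s\<bar> * \<bar>y - y'\<bar>"
        by (metis abs_mult abs_triangle_ineq)
    qed auto
    also have "\<dots> = K * \<bar>x - x'\<bar> + L * \<bar>y - y'\<bar>"
      by (simp add: K_def L_def sum.distrib sum_distrib_right distrib_left mult.assoc)
    finally show ?thesis .
  qed
  have K0: "K \<ge> 0" "L \<ge> 0" unfolding K_def L_def by (auto intro!: sum_nonneg)
  have "(K + L)-lipschitz_on UNIV (\<lambda>(x, y). F (\<lambda>s. z s + x * a s + y * b s))"
  proof (rule lipschitz_onI)
    fix p q :: "real \<times> real"
    obtain x y x' y' where [simp]: "p = (x, y)" "q = (x', y')" by (cases p, cases q)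
    have "\<bar>x - x'\<bar> \<le> dist p q" "\<bar>y - y'\<bar> \<le> dist p q"
      using dist_fst_le[of p q] dist_snd_le[of p q] by (auto simp: dist_real_def)
    then have "K * \<bar>x - x'\<bar> + L * \<bar>y - y'\<bar> \<le> K * dist p q + L * dist p q"
      using K0 by (intro add_mono mult_left_mono)
    with lip[of x y x' y'] show "dist (case p of (x, y) \<Rightarrow> F (\<lambda>s. z s + x * a s + y * b s))
           (case q of (x, y) \<Rightarrow> F (\<lambda>s. z s + x * a s + y * b s)) \<le> (K + L) * dist p q"
      by (simp add: dist_real_def algebra_simps)
  qed (use K0 in simp)
  then have "continuous_on UNIV (\<lambda>(x, y). F (\<lambda>s. z s + x * a s + y * b s))"
    by (rule lipschitz_on_continuous_on)
  then have meas: "(\<lambda>(x, y). F (\<lambda>s. z s + x * a s + y * b s)) \<in> borel_measurable borel"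
    by (rule borel_measurable_continuous_onI)
  also have "borel_measurable borel =
      borel_measurable (std_normal_distribution \<Otimes>\<^sub>M std_normal_distribution)"
    by (intro measurable_cong_sets) (auto simp: borel_prod[symmetric] intro!: sets_pair_measure_cong)
  finally have meas': "(\<lambda>(x, y). F (\<lambda>s. z s + x * a s + y * b s))
           \<in> borel_measurable (std_normal_distribution \<Otimes>\<^sub>M std_normal_distribution)" .
  have "integrable (std_normal_distribution \<Otimes>\<^sub>M std_normal_distribution) (\<lambda>p. \<bar>fst p\<bar>)"
    by (rule std_normal_pair.Fubini_integrable) simp_all
  moreover have "integrable (std_normal_distribution \<Otimes>\<^sub>M std_normal_distribution) (\<lambda>p. \<bar>snd p\<bar>)"
    by (rule std_normal_pair.Fubini_integrable) simp_all
  ultimately have bnd: "integrable (std_normal_distribution \<Otimes>\<^sub>M std_normal_distribution)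
      (\<lambda>p. \<bar>F z\<bar> + K * \<bar>fst p\<bar> + L * \<bar>snd p\<bar>)"
    by auto
  have "norm (F (\<lambda>s. z s + x * a s + y * b s)) \<le> norm (\<bar>F z\<bar> + K * \<bar>x\<bar> + L * \<bar>y\<bar>)" for x y
    using lip[of x y 0 0] K0 by (simp add: abs_if split: if_splits)
  then show "integrable (std_normal_distribution \<Otimes>\<^sub>M std_normal_distribution)
           (\<lambda>(x, y). F (\<lambda>s. z s + x * a s + y * b s))"
    by (intro Bochner_Integration.integrable_bound[OF bnd meas' AE_I2]) auto
qed

lemma gauss_avg_gauss_avg:
  "gauss_avg a (gauss_avg b F) z =
    (\<integral>x. \<integral>y. F (\<lambda>s. z s + x * a s + y * b s) \<partial>std_normal_distribution \<partial>std_normal_distribution)"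
  by (simp add: gauss_avg_def)

lemma gauss_avg_commute:
  assumes "lipschitz_coords S c F"
  shows "gauss_avg a (gauss_avg b F) = gauss_avg b (gauss_avg a F)"
proof
  fix z
  have "gauss_avg a (gauss_avg b F) z =
    (\<integral>y. \<integral>x. F (\<lambda>s. z s + x * a s + y * b s) \<partial>std_normal_distribution \<partial>std_normal_distribution)"
    unfolding gauss_avg_gauss_avg
    by (rule std_normal_pair.Fubini_integral[symmetric, OF integrable_lipschitz_coords_plane[OF assms]])
  then show "gauss_avg a (gauss_avg b F) z = gauss_avg b (gauss_avg a F) z"
    by (simp add: gauss_avg_gauss_avg add.assoc add.left_commute) (simp add: algebra_simps)
qed

lemma distr_scale_std_normal:
  assumes "\<sigma> > 0"
  shows "distr std_normal_distribution lborel (\<lambda>x. \<sigma> * x) = density lborel (normal_density 0 \<sigma>)"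
proof -
  have "distributed std_normal_distribution lborel (\<lambda>x. x) std_normal_density"
    by (auto simp: distributed_def intro!: distr_id2)
  from std_normal.normal_density_affine[OF this, of \<sigma> 0] assms
  show ?thesis by (simp add: distributed_def)
qed

text \<open>The law of \<open>\<sigma> * x + \<tau> * y\<close> is the convolution of two centred
  normal laws, and their variances add.\<close>

lemma integral_std_normal_add:
  fixes f :: "real \<Rightarrow> real"
  assumes f [measurable]: "f \<in> borel_measurable borel" and pos: "\<sigma> > 0" "\<tau> > 0"
    and int: "integrable (std_normal_distribution \<Otimes>\<^sub>M std_normal_distribution) (\<lambda>(x, y). f (\<sigma> * x + \<tau> * y))"
  shows "(\<integral>x. \<integral>y. f (\<sigma> * x + \<tau> * y) \<partial>std_normal_distribution \<partial>std_normal_distribution)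
       = (\<integral>x. f (sqrt (\<sigma>\<^sup>2 + \<tau>\<^sup>2) * x) \<partial>std_normal_distribution)"
proof -
  define P where "P = std_normal_distribution \<Otimes>\<^sub>M std_normal_distribution"
  have [measurable_cong]: "sets P = sets (borel \<Otimes>\<^sub>M borel)"
    unfolding P_def by (intro sets_pair_measure_cong) auto
  let ?N = "\<lambda>\<sigma>. density lborel (normal_density 0 \<sigma>)"
  have N: "prob_space (?N \<sigma>)" if "\<sigma> > 0" for \<sigma>
    using that by (rule prob_space_normal_density)
  have "distr P borel (\<lambda>(x, y). \<sigma> * x + \<tau> * y)
      = distr (distr P (borel \<Otimes>\<^sub>M borel) (\<lambda>(x, y). (\<sigma> * x, \<tau> * y))) borel (\<lambda>(x, y). x + y)"
    by (subst distr_distr) (auto simp: comp_def case_prod_unfold)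
  also have "distr P (borel \<Otimes>\<^sub>M borel) (\<lambda>(x, y). (\<sigma> * x, \<tau> * y))
      = distr std_normal_distribution borel (\<lambda>x. \<sigma> * x) \<Otimes>\<^sub>M distr std_normal_distribution borel (\<lambda>x. \<tau> * x)"
    unfolding P_def
    by (subst pair_measure_distr)
       (auto intro!: prob_space_imp_sigma_finite std_normal.prob_space_distr)
  also have "\<dots> = ?N \<sigma> \<Otimes>\<^sub>M ?N \<tau>"
    using distr_scale_std_normal[OF pos(1)] distr_scale_std_normal[OF pos(2)]
    by (simp cong: distr_cong)
  also have "distr (?N \<sigma> \<Otimes>\<^sub>M ?N \<tau>) borel (\<lambda>(x, y). x + y) = convolution (?N \<sigma>) (?N \<tau>)"
    by (simp add: convolution_def)
  also have "\<dots> = ?N (sqrt (\<sigma>\<^sup>2 + \<tau>\<^sup>2))"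
    using conv_normal_density_zero_mean[OF pos] pos
    by (subst convolution_density)
       (auto intro!: N prob_space.finite_measure simp: ennreal_mult'[symmetric])
  also have "\<dots> = distr std_normal_distribution lborel (\<lambda>x. sqrt (\<sigma>\<^sup>2 + \<tau>\<^sup>2) * x)"
    using pos by (intro distr_scale_std_normal[symmetric]) (auto intro: add_pos_pos)
  finally have eq: "distr P borel (\<lambda>(x, y). \<sigma> * x + \<tau> * y)
    = distr std_normal_distribution lborel (\<lambda>x. sqrt (\<sigma>\<^sup>2 + \<tau>\<^sup>2) * x)" .
  have "(\<integral>x. \<integral>y. f (\<sigma> * x + \<tau> * y) \<partial>std_normal_distribution \<partial>std_normal_distribution)
      = (\<integral>p. f ((\<lambda>(x, y). \<sigma> * x + \<tau> * y) p) \<partial>P)"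
    unfolding P_def using int by (subst std_normal_pair.integral_fst) (simp_all add: case_prod_unfold)
  also have "\<dots> = integral\<^sup>L (distr P borel (\<lambda>(x, y). \<sigma> * x + \<tau> * y)) f"
    by (rule integral_distr[symmetric]) auto
  also have "\<dots> = (\<integral>x. f (sqrt (\<sigma>\<^sup>2 + \<tau>\<^sup>2) * x) \<partial>std_normal_distribution)"
    unfolding eq by (rule integral_distr) auto
  finally show ?thesis .
qed

text \<open>The semigroup law along a single direction; it reassembles many small steps into one
  full step.\<close>

lemma gauss_avg_add_variance:
  assumes "lipschitz_coords S c F" and pos: "\<sigma> > 0" "\<tau> > 0"
  shows "gauss_avg (\<lambda>s. \<sigma> * a s) (gauss_avg (\<lambda>s. \<tau> * a s) F) = gauss_avg (\<lambda>s. sqrt (\<sigma>\<^sup>2 + \<tau>\<^sup>2) * a s) F"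
proof
  fix z
  define f where "f x = F (\<lambda>s. z s + x * a s)" for x
  have eq: "F (\<lambda>s. z s + x * (\<sigma> * a s) + y * (\<tau> * a s)) = f (\<sigma> * x + \<tau> * y)" for x y
    by (simp add: f_def algebra_simps)
  have "f \<in> borel_measurable borel"
    using borel_measurable_integrable[OF integrable_gauss_avg[OF assms(1), of z a]]
    by (simp add: f_def [abs_def])
  moreover have "integrable (std_normal_distribution \<Otimes>\<^sub>M std_normal_distribution) (\<lambda>(x, y). f (\<sigma> * x + \<tau> * y))"
    using integrable_lipschitz_coords_plane[OF assms(1), of z "\<lambda>s. \<sigma> * a s" "\<lambda>s. \<tau> * a s"] by (simp add: eq)
  ultimately have "gauss_avg (\<lambda>s. \<sigma> * a s) (gauss_avg (\<lambda>s. \<tau> * a s) F) z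
      = (\<integral>x. f (sqrt (\<sigma>\<^sup>2 + \<tau>\<^sup>2) * x) \<partial>std_normal_distribution)"
    unfolding gauss_avg_gauss_avg eq using pos by (intro integral_std_normal_add)
  then show "gauss_avg (\<lambda>s. \<sigma> * a s) (gauss_avg (\<lambda>s. \<tau> * a s) F) z = gauss_avg (\<lambda>s. sqrt (\<sigma>\<^sup>2 + \<tau>\<^sup>2) * a s) F z"
    by (simp add: gauss_avg_def f_def mult_ac)
qed

text \<open>The list encodes a centred Gaussian process: each direction receives its own independent
  standard normal coefficient, so the covariance is \<open>\<Sum>a\<leftarrow>as. a s * a t\<close>.
  Appending two lists adds independent processes.\<close>

definition gauss_avgs :: "('s \<Rightarrow> real) list \<Rightarrow> (('s \<Rightarrow> real) \<Rightarrow> real) \<Rightarrow> ('s \<Rightarrow> real) \<Rightarrow> real" where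
  "gauss_avgs as F = foldr gauss_avg as F"

lemma gauss_avgs_simps [simp]:
  "gauss_avgs [] F = F"
  "gauss_avgs (a # as) F = gauss_avg a (gauss_avgs as F)"
  "gauss_avgs (as @ bs) F = gauss_avgs as (gauss_avgs bs F)"
  by (simp_all add: gauss_avgs_def)

lemma lipschitz_coords_gauss_avgs:
  "lipschitz_coords S c F \<Longrightarrow> lipschitz_coords S c (gauss_avgs as F)"
  by (induction as) (auto intro: lipschitz_coords_gauss_avg)

lemma lipschitz_coords_gauss_avgs_funpow:
  "lipschitz_coords S c F \<Longrightarrow> lipschitz_coords S c ((gauss_avgs as ^^ k) F)"
  by (induction k) (auto intro: lipschitz_coords_gauss_avgs)

lemma gauss_avgs_mono:
  assumes "lipschitz_coords S c F" "lipschitz_coords S c G" "\<And>z. F z \<le> G z + e"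
  shows "gauss_avgs as F z \<le> gauss_avgs as G z + e"
proof (induction as arbitrary: z)
  case (Cons a as)
  then show ?case
    by (auto intro: gauss_avg_mono lipschitz_coords_gauss_avgs[OF assms(1)] lipschitz_coords_gauss_avgs[OF assms(2)])
qed (use assms in auto)

lemma gauss_avg_gauss_avgs_commute:
  assumes "lipschitz_coords S c F"
  shows "gauss_avg a (gauss_avgs bs F) = gauss_avgs bs (gauss_avg a F)"
proof (induction bs)
  case (Cons b bs)
  then show ?case
    by (simp add: gauss_avg_commute[OF lipschitz_coords_gauss_avgs[OF assms], of a b])
qed simp

lemma gauss_avgs_commute:
  assumes "lipschitz_coords S c F"
  shows "gauss_avgs as (gauss_avgs bs F) = gauss_avgs bs (gauss_avgs as F)"
proof (induction as)
  case (Cons a as)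
  then show ?case
    by (simp add: gauss_avg_gauss_avgs_commute[OF lipschitz_coords_gauss_avgs[OF assms]])
qed simp

lemma gauss_avgs_funpow_commute:
  assumes "lipschitz_coords S c F"
  shows "gauss_avgs as ((gauss_avgs bs ^^ k) F) = (gauss_avgs bs ^^ k) (gauss_avgs as F)"
  by (induction k)
     (simp_all add: gauss_avgs_commute[OF lipschitz_coords_gauss_avgs_funpow[OF assms], of as bs])

lemma gauss_avg_funpow:
  assumes "lipschitz_coords S c F" "r > 0"
  shows "(gauss_avg (\<lambda>s. r * a s) ^^ Suc k) F = gauss_avg (\<lambda>s. sqrt (real (Suc k)) * r * a s) F"
proof (induction k)
  case (Suc k)
  have eq: "sqrt (r\<^sup>2 + (sqrt (real (Suc k)) * r)\<^sup>2) = sqrt (real (Suc (Suc k))) * r"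
  proof -
    have "r\<^sup>2 + (sqrt (real (Suc k)) * r)\<^sup>2 = real (Suc (Suc k)) * r\<^sup>2"
      by (simp add: power_mult_distrib algebra_simps)
    then show ?thesis using assms(2) by (simp add: real_sqrt_mult)
  qed
  have "(gauss_avg (\<lambda>s. r * a s) ^^ Suc (Suc k)) F
      = gauss_avg (\<lambda>s. r * a s) (gauss_avg (\<lambda>s. sqrt (real (Suc k)) * r * a s) F)"
    using Suc.IH by simp
  also have "\<dots> = gauss_avg (\<lambda>s. sqrt (r\<^sup>2 + (sqrt (real (Suc k)) * r)\<^sup>2) * a s) F"
    by (rule gauss_avg_add_variance[OF assms(1)]) (use assms(2) in auto)
  finally show ?case unfolding eq .
qed simp

lemma gauss_avgs_Cons_funpow:
  assumes "lipschitz_coords S c F"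
  shows "(gauss_avgs (a # as) ^^ k) F = (gauss_avg a ^^ k) ((gauss_avgs as ^^ k) F)"
proof (induction k)
  case (Suc k)
  have eq: "gauss_avgs [a] = gauss_avg a" by (simp add: fun_eq_iff)
  have "gauss_avgs as ((gauss_avgs [a] ^^ k) ((gauss_avgs as ^^ k) F))
      = (gauss_avgs [a] ^^ k) (gauss_avgs as ((gauss_avgs as ^^ k) F))"
    by (rule gauss_avgs_funpow_commute[OF lipschitz_coords_gauss_avgs_funpow[OF assms]])
  with Suc show ?case by (simp add: eq)
qed simp

text \<open>Commutation gathers the \<open>N\<close> small copies of each direction, and their
  variances \<open>1 / N\<close> add up to one.\<close>

lemma gauss_avgs_divide:
  assumes "lipschitz_coords S c F" "N > 0"
  shows "(gauss_avgs (map (\<lambda>a s. 1 / sqrt (real N) * a s) as) ^^ N) F = gauss_avgs as F"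
proof (induction as)
  case Nil
  have "((\<lambda>F. F) ^^ k) F = F" for k by (induction k) auto
  then show ?case by (simp add: gauss_avgs_def)
next
  case (Cons a as)
  obtain k where k: "N = Suc k" using assms(2) by (cases N) auto
  have "(gauss_avg (\<lambda>s. 1 / sqrt (real N) * a s) ^^ N) (gauss_avgs as F)
      = gauss_avg (\<lambda>s. sqrt (real N) * (1 / sqrt (real N)) * a s) (gauss_avgs as F)"
    unfolding k by (rule gauss_avg_funpow[OF lipschitz_coords_gauss_avgs[OF assms(1)]]) simp
  then show ?case
    using Cons assms by (simp add: gauss_avgs_Cons_funpow[OF assms(1)] del: gauss_avgs_simps(2)) simp
qed

text \<open>The factors \<open>bs\<close> are exchanged for \<open>as\<close> one at a time. The
  hypothesis compares the two averages of \<open>F\<close> only, so it is first averaged by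
  \<open>as ^^ k\<close> and then commutation moves the extra factor to the outside. Averages are
  monotone and preserve constants, so each exchange costs the same \<open>e\<close>.\<close>

lemma gauss_avgs_funpow_mono:
  assumes F: "lipschitz_coords S c F" and step: "\<And>z. gauss_avgs bs F z \<le> gauss_avgs as F z + e"
  shows "(gauss_avgs bs ^^ k) F z \<le> (gauss_avgs as ^^ k) F z + real k * e"
proof (induction k arbitrary: z)
  case (Suc k)
  have 1: "gauss_avgs bs ((gauss_avgs bs ^^ k) F) z \<le> gauss_avgs bs ((gauss_avgs as ^^ k) F) z + real k * e"
    by (rule gauss_avgs_mono[OF lipschitz_coords_gauss_avgs_funpow[OF F] lipschitz_coords_gauss_avgs_funpow[OF F] Suc])
  have step': "(gauss_avgs as ^^ k) (gauss_avgs bs F) z \<le> (gauss_avgs as ^^ k) (gauss_avgs as F) z + e" for z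
  proof (induction k arbitrary: z)
    case (Suc k)
    then show ?case
      by (auto intro!: gauss_avgs_mono lipschitz_coords_gauss_avgs_funpow lipschitz_coords_gauss_avgs F)
  qed (use step in simp)
  have 2: "gauss_avgs bs ((gauss_avgs as ^^ k) F) z \<le> gauss_avgs as ((gauss_avgs as ^^ k) F) z + e"
    using step'[of z] by (simp add: gauss_avgs_funpow_commute[OF F])
  from 1 2 show ?case by (simp add: algebra_simps)
qed simp

subsection \<open>Log-sum-exp under small Gaussian perturbations\<close>

definition lse :: "'s set \<Rightarrow> ('s \<Rightarrow> real) \<Rightarrow> real" where
  "lse S z = ln (\<Sum>s\<in>S. exp (z s))"

text \<open>Expectation under the Gibbs measure on \<open>S\<close> with weights proportional to
  \<open>exp (z s)\<close>. This mean and the corresponding variance are the first and second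
  derivatives of \<open>lse\<close> along \<open>f\<close>.\<close>

definition tilted_mean :: "'s set \<Rightarrow> ('s \<Rightarrow> real) \<Rightarrow> ('s \<Rightarrow> real) \<Rightarrow> real" where
  "tilted_mean S z f = (\<Sum>s\<in>S. f s * exp (z s)) / (\<Sum>s\<in>S. exp (z s))"

definition tilted_var :: "'s set \<Rightarrow> ('s \<Rightarrow> real) \<Rightarrow> ('s \<Rightarrow> real) \<Rightarrow> real" where
  "tilted_var S z f = tilted_mean S z (\<lambda>s. (f s)\<^sup>2) - (tilted_mean S z f)\<^sup>2"

context
  fixes S :: "'s set"
  assumes S: "finite S" "S \<noteq> {}"
begin

lemma sum_exp_pos: "(\<Sum>s\<in>S. exp (z s :: real)) > 0"
  using S by (intro sum_pos) auto

lemma lipschitz_coords_lse: "lipschitz_coords S (\<lambda>_. 1) (lse S)"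
proof -
  have *: "lse S z \<le> lse S w + (\<Sum>s\<in>S. \<bar>z s - w s\<bar>)" for z w
  proof -
    define D where "D = (\<Sum>s\<in>S. \<bar>z s - w s\<bar>)"
    have "exp (z s) \<le> exp D * exp (w s)" if "s \<in> S" for s
    proof -
      have "\<bar>z s - w s\<bar> \<le> D"
        unfolding D_def using S that by (intro member_le_sum) auto
      then show ?thesis by (simp add: exp_add[symmetric])
    qed
    then have "(\<Sum>s\<in>S. exp (z s)) \<le> exp D * (\<Sum>s\<in>S. exp (w s))"
      by (simp add: sum_distrib_left sum_mono)
    then have "lse S z \<le> ln (exp D * (\<Sum>s\<in>S. exp (w s)))"
      unfolding lse_def using sum_exp_pos[of z] by (intro ln_mono) auto
    also have "\<dots> = lse S w + D"
      using sum_exp_pos[of w] by (simp add: lse_def ln_mult)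
    finally show ?thesis by (simp add: D_def)
  qed
  show ?thesis
    unfolding lipschitz_coords_def
  proof (intro allI)
    fix z w
    show "\<bar>lse S z - lse S w\<bar> \<le> (\<Sum>s\<in>S. 1 * \<bar>z s - w s\<bar>)"
      using *[of z w] *[of w z] by (simp add: abs_minus_commute abs_le_iff)
  qed
qed

lemma Max_le_lse: "Max (z ` S) \<le> lse S z"
proof -
  have "z s \<le> lse S z" if "s \<in> S" for s
  proof -
    have "exp (z s) \<le> (\<Sum>s\<in>S. exp (z s))" using S that by (intro member_le_sum) auto
    then show ?thesis using sum_exp_pos[of z] by (simp add: lse_def ln_ge_iff)
  qed
  then show ?thesis using S by simp
qed

lemma lse_le_Max: "lse S z \<le> Max (z ` S) + ln (real (card S))"
proof -
  have "(\<Sum>s\<in>S. exp (z s)) \<le> real (card S) * exp (Max (z ` S))"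
    using S by (intro sum_bounded_above) auto
  then have "lse S z \<le> ln (real (card S) * exp (Max (z ` S)))"
    unfolding lse_def using sum_exp_pos[of z] by (intro ln_mono) auto
  also have "\<dots> = Max (z ` S) + ln (real (card S))"
    using S by (subst ln_mult) (auto simp: card_gt_0_iff)
  finally show ?thesis .
qed

lemma abs_tilted_mean_le:
  assumes "\<And>s. s \<in> S \<Longrightarrow> \<bar>f s\<bar> \<le> B"
  shows "\<bar>tilted_mean S z f\<bar> \<le> B"
proof -
  have "\<bar>\<Sum>s\<in>S. f s * exp (z s)\<bar> \<le> (\<Sum>s\<in>S. B * exp (z s))"
    using assms by (intro sum_abs[THEN order_trans] sum_mono) (auto simp: abs_mult)
  then show ?thesis
    using sum_exp_pos[of z]
    by (simp add: tilted_mean_def divide_le_eq sum_distrib_left[symmetric])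
qed

lemma DERIV_sum_exp:
  "((\<lambda>u. \<Sum>s\<in>S. f s * exp (z s + u * b s)) has_real_derivative
     (\<Sum>s\<in>S. f s * b s * exp (z s + u * b s))) (at u)"
proof -
  have "((\<lambda>u. f s * exp (z s + u * b s)) has_real_derivative f s * b s * exp (z s + u * b s)) (at u)" for s
    by (auto intro!: derivative_eq_intros)
  then show ?thesis by (intro DERIV_sum)
qed

lemma DERIV_tilted_mean:
  "((\<lambda>u. tilted_mean S (\<lambda>s. z s + u * b s) f) has_real_derivative
     tilted_mean S (\<lambda>s. z s + u * b s) (\<lambda>s. f s * b s)
     - tilted_mean S (\<lambda>s. z s + u * b s) f * tilted_mean S (\<lambda>s. z s + u * b s) b) (at u)"
proof -
  define w where "w = (\<lambda>s. z s + u * b s)"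
  have pos: "(\<Sum>s\<in>S. exp (w s)) > 0" by (rule sum_exp_pos)
  have "((\<lambda>u. (\<Sum>s\<in>S. f s * exp (z s + u * b s)) / (\<Sum>s\<in>S. 1 * exp (z s + u * b s))) has_real_derivative
     ((\<Sum>s\<in>S. f s * b s * exp (w s)) * (\<Sum>s\<in>S. 1 * exp (w s))
      - (\<Sum>s\<in>S. f s * exp (w s)) * (\<Sum>s\<in>S. 1 * b s * exp (w s)))
     / ((\<Sum>s\<in>S. 1 * exp (w s)) * (\<Sum>s\<in>S. 1 * exp (w s)))) (at u)"
    unfolding w_def using sum_exp_pos[of "\<lambda>s. z s + u * b s"] by (intro DERIV_divide DERIV_sum_exp) auto
  moreover have "(p * t - q * r) / (t * t) = p / t - q / t * (r / t)" if "t > 0" for p q r t :: real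
    using that by (simp add: field_simps)
  ultimately show ?thesis
    using pos by (simp add: tilted_mean_def w_def)
qed

lemma DERIV_lse:
  "((\<lambda>u. lse S (\<lambda>s. z s + u * b s)) has_real_derivative tilted_mean S (\<lambda>s. z s + u * b s) b) (at u)"
proof -
  have "((\<lambda>u. ln (\<Sum>s\<in>S. 1 * exp (z s + u * b s))) has_real_derivative
     1 / (\<Sum>s\<in>S. 1 * exp (z s + u * b s)) * (\<Sum>s\<in>S. 1 * b s * exp (z s + u * b s))) (at u)"
    using sum_exp_pos[of "\<lambda>s. z s + u * b s"] by (intro DERIV_chain'[OF DERIV_sum_exp] DERIV_ln_divide) simp
  then show ?thesis by (simp add: lse_def tilted_mean_def)
qed

text \<open>The derivative consists of Gibbs means of products of \<open>a\<close> and
  \<open>b\<close>. Its three parts contribute \<open>A\<^sup>2 * B\<close>,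
  \<open>A\<^sup>2 * B\<close> and \<open>(2 * A) * (2 * (A * B))\<close>, independently of
  \<open>z\<close> and \<open>u\<close>.\<close>

lemma DERIV_tilted_var:
  assumes A: "\<And>s. s \<in> S \<Longrightarrow> \<bar>a s\<bar> \<le> A" and B: "\<And>s. s \<in> S \<Longrightarrow> \<bar>b s\<bar> \<le> B"
  shows "\<exists>D. \<forall>u. ((\<lambda>u. tilted_var S (\<lambda>s. z s + u * b s) a) has_real_derivative D u) (at u)
    \<and> \<bar>D u\<bar> \<le> 6 * A\<^sup>2 * B"
proof (intro exI allI conjI)
  fix u
  define m where "m = tilted_mean S (\<lambda>s. z s + u * b s)"
  obtain s where s: "s \<in> S" using S by auto
  have A0: "A \<ge> 0" and B0: "B \<ge> 0" using A[OF s] B[OF s] by auto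
  let ?m = "\<lambda>u. tilted_mean S (\<lambda>s. z s + u * b s)"
  let ?D = "\<lambda>u. ?m u (\<lambda>s. (a s)\<^sup>2 * b s) - ?m u (\<lambda>s. (a s)\<^sup>2) * ?m u b
     - 2 * ?m u a * (?m u (\<lambda>s. a s * b s) - ?m u a * ?m u b)"
  show "((\<lambda>u. tilted_var S (\<lambda>s. z s + u * b s) a) has_real_derivative ?D u) (at u)"
    unfolding tilted_var_def
    by (rule derivative_eq_intros DERIV_tilted_mean refl)+ simp
  have A2: "(a s)\<^sup>2 \<le> A\<^sup>2" if "s \<in> S" for s
    using A[OF that] A0 by (simp add: abs_le_square_iff[symmetric])
  have "\<bar>m a\<bar> \<le> A" "\<bar>m b\<bar> \<le> B" "\<bar>m (\<lambda>s. (a s)\<^sup>2)\<bar> \<le> A\<^sup>2"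
    "\<bar>m (\<lambda>s. a s * b s)\<bar> \<le> A * B" "\<bar>m (\<lambda>s. (a s)\<^sup>2 * b s)\<bar> \<le> A\<^sup>2 * B"
    unfolding m_def using A B A0 B0 A2
    by (auto intro!: abs_tilted_mean_le mult_mono simp: abs_mult)
  note m = this
  have "\<bar>m (\<lambda>s. (a s)\<^sup>2) * m b\<bar> \<le> A\<^sup>2 * B"
    unfolding abs_mult using m A0 B0 by (intro mult_mono) auto
  moreover have "\<bar>m a * m b\<bar> \<le> A * B"
    unfolding abs_mult using m A0 B0 by (intro mult_mono) auto
  then have "\<bar>m (\<lambda>s. a s * b s) - m a * m b\<bar> \<le> 2 * (A * B)"
    using m by linarith
  then have "\<bar>2 * m a * (m (\<lambda>s. a s * b s) - m a * m b)\<bar> \<le> (2 * A) * (2 * (A * B))"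
    unfolding abs_mult[of "2 * m a"] using m A0 B0 by (intro mult_mono) auto
  ultimately show "\<bar>?D u\<bar> \<le> 6 * A\<^sup>2 * B"
    using m(5) unfolding m_def[symmetric] by (simp add: power2_eq_square)
qed

lemma tilted_var_lipschitz:
  assumes A: "\<And>s. s \<in> S \<Longrightarrow> \<bar>a s\<bar> \<le> A" and B: "\<And>s. s \<in> S \<Longrightarrow> \<bar>b s\<bar> \<le> B"
  shows "\<bar>tilted_var S (\<lambda>s. z s + u * b s) a - tilted_var S z a\<bar> \<le> 6 * A\<^sup>2 * B * \<bar>u\<bar>"
proof -
  obtain D where D: "\<And>u. ((\<lambda>u. tilted_var S (\<lambda>s. z s + u * b s) a) has_real_derivative D u) (at u)"
       "\<And>u. \<bar>D u\<bar> \<le> 6 * A\<^sup>2 * B" using DERIV_tilted_var[where a=a and b=b and z=z, OF A B] by auto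
  have "norm (tilted_var S (\<lambda>s. z s + u * b s) a - tilted_var S (\<lambda>s. z s + 0 * b s) a)
      \<le> 6 * A\<^sup>2 * B * norm (u - 0)"
    by (rule field_differentiable_bound[of UNIV _ D]) (use D in auto)
  then show ?thesis by simp
qed

text \<open>The third derivative is at most \<open>6 * B ^ 3\<close>, and the \<open>fact 3\<close>
  of the Lagrange remainder cancels the \<open>6\<close>.\<close>

lemma lse_Taylor:
  assumes B: "\<And>s. s \<in> S \<Longrightarrow> \<bar>b s\<bar> \<le> B"
  shows "\<bar>lse S (\<lambda>s. z s + u * b s) - (lse S z + u * tilted_mean S z b + u\<^sup>2 / 2 * tilted_var S z b)\<bar>
     \<le> B ^ 3 * \<bar>u\<bar> ^ 3"
proof -
  obtain D where D: "\<And>u. ((\<lambda>u. tilted_var S (\<lambda>s. z s + u * b s) b) has_real_derivative D u) (at u)"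
       "\<And>u. \<bar>D u\<bar> \<le> 6 * B\<^sup>2 * B" using DERIV_tilted_var[where a=b and b=b and z=z, OF B B] by auto
  define diff where "diff k = (if k = 0 then (\<lambda>u. lse S (\<lambda>s. z s + u * b s))
     else if k = 1 then (\<lambda>u. tilted_mean S (\<lambda>s. z s + u * b s) b)
     else if k = 2 then (\<lambda>u. tilted_var S (\<lambda>s. z s + u * b s) b) else D)" for k :: nat
  have "DERIV (diff k) t :> diff (Suc k) t" if "k < 3" for k t
  proof -
    have "k = 0 \<or> k = 1 \<or> k = 2" using that by linarith
    then consider "k = 0" | "k = 1" | "k = 2" by blast
    then show ?thesis
    proof cases
      case 1 then show ?thesis using DERIV_lse by (simp add: diff_def)
    next
      case 2 then show ?thesis
        using DERIV_tilted_mean[of z b b t] by (simp add: diff_def tilted_var_def power2_eq_square)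
    next
      case 3 then show ?thesis using D(1) by (simp add: diff_def)
    qed
  qed
  then obtain t where t: "lse S (\<lambda>s. z s + u * b s) = (\<Sum>m<3. diff m 0 / fact m * u ^ m) + diff 3 t / fact 3 * u ^ 3"
    using Maclaurin_bi_le[of diff "\<lambda>u. lse S (\<lambda>s. z s + u * b s)" 3 u] by (auto simp: diff_def)
  then have "lse S (\<lambda>s. z s + u * b s) - (lse S z + u * tilted_mean S z b + u\<^sup>2 / 2 * tilted_var S z b) = D t / 6 * u ^ 3"
    by (simp add: diff_def eval_nat_numeral fact_reduce)
  moreover have "\<bar>D t / 6 * u ^ 3\<bar> \<le> B ^ 3 * \<bar>u\<bar> ^ 3"
    unfolding abs_mult power_abs using D(2)[of t]
    by (intro mult_right_mono) (auto simp: power2_eq_square power3_eq_cube)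
  ultimately show ?thesis by (simp only:)
qed

end

section \<open>Expansion of one Gaussian step, and the comparison for log-sum-exp\<close>

context
  fixes S :: "'s set"
  assumes S: "finite S" "S \<noteq> {}"
begin

text \<open>Shaped for induction on the directions: \<open>G\<close> is the average over the
  directions already treated, \<open>v\<close> is their second-order contribution frozen at
  \<open>z\<close>, and \<open>d * \<bar>x\<bar>\<close> pays for the freezing. Under the integral
  the linear term vanishes, and the unit second moment leaves half the tilted variance.\<close>

lemma gauss_avg_lse_Taylor:
  assumes B: "\<And>s. s \<in> S \<Longrightarrow> \<bar>b s\<bar> \<le> B" and r: "r \<ge> 0"
    and near: "\<And>x. \<bar>G (\<lambda>s. z s + x * (r * b s)) - (lse S (\<lambda>s. z s + x * (r * b s)) + v)\<bar> \<le> r ^ 3 * (c + d * \<bar>x\<bar>)"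
    and G: "lipschitz_coords S k G"
  shows "\<bar>gauss_avg (\<lambda>s. r * b s) G z - (lse S z + v + r\<^sup>2 / 2 * tilted_var S z b)\<bar>
    \<le> r ^ 3 * (c + d * (\<integral>x. \<bar>x\<bar> \<partial>std_normal_distribution)
        + B ^ 3 * (\<integral>x. \<bar>x\<bar> ^ 3 \<partial>std_normal_distribution))"
proof -
  let ?N = std_normal_distribution
  define p where "p x = lse S z + v + x * (r * tilted_mean S z b) + x\<^sup>2 * (r\<^sup>2 / 2 * tilted_var S z b)" for x
  have p: "integrable ?N p" "(\<integral>x. p x \<partial>?N) = lse S z + v + r\<^sup>2 / 2 * tilted_var S z b"
    unfolding p_def by simp_all
  have int: "integrable ?N (\<lambda>x. G (\<lambda>s. z s + x * (r * b s)) - p x)"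
    by (intro Bochner_Integration.integrable_diff integrable_gauss_avg[OF G] p)
  have ptw: "\<bar>G (\<lambda>s. z s + x * (r * b s)) - p x\<bar> \<le> r ^ 3 * (c + d * \<bar>x\<bar> + B ^ 3 * \<bar>x\<bar> ^ 3)" for x
  proof -
    have "\<bar>lse S (\<lambda>s. z s + (x * r) * b s) - (lse S z + (x * r) * tilted_mean S z b + (x * r)\<^sup>2 / 2 * tilted_var S z b)\<bar>
        \<le> B ^ 3 * \<bar>x * r\<bar> ^ 3"
      by (rule lse_Taylor[OF S B])
    then have "\<bar>lse S (\<lambda>s. z s + x * (r * b s)) + v - p x\<bar> \<le> B ^ 3 * (\<bar>x\<bar> ^ 3 * r ^ 3)"
      using r by (simp add: p_def power_mult_distrib abs_mult mult.assoc algebra_simps)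
    with near[of x] show ?thesis
      by (simp add: distrib_left mult_ac)
  qed
  have "gauss_avg (\<lambda>s. r * b s) G z - (lse S z + v + r\<^sup>2 / 2 * tilted_var S z b)
      = (\<integral>x. G (\<lambda>s. z s + x * (r * b s)) - p x \<partial>?N)"
    unfolding gauss_avg_def
    by (subst Bochner_Integration.integral_diff) (simp_all add: integrable_gauss_avg[OF G] p)
  also have "\<bar>\<dots>\<bar> \<le> (\<integral>x. \<bar>G (\<lambda>s. z s + x * (r * b s)) - p x\<bar> \<partial>?N)"
    by (rule integral_abs_bound)
  also have "\<dots> \<le> (\<integral>x. r ^ 3 * (c + d * \<bar>x\<bar> + B ^ 3 * \<bar>x\<bar> ^ 3) \<partial>?N)"
    using int ptw by (intro integral_mono integrable_abs) simp_all
  also have "\<dots> = r ^ 3 * (c + d * (\<integral>x. \<bar>x\<bar> \<partial>?N) + B ^ 3 * (\<integral>x. \<bar>x\<bar> ^ 3 \<partial>?N))"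
    by (simp del: integral_std_normal_abs)
  finally show ?thesis by simp
qed

lemma bounded_on_finite: "\<exists>B. \<forall>s\<in>S. \<bar>(b :: 's \<Rightarrow> real) s\<bar> \<le> B"
  using S by (intro exI[of _ "Max ((\<lambda>s. \<bar>b s\<bar>) ` S)"]) auto

text \<open>Bounds the cost of evaluating the second-order term at a shifted point, with a constant
  that does not depend on that point.\<close>

lemma sum_list_tilted_var_lipschitz:
  "\<exists>D. \<forall>z u. \<bar>(\<Sum>a\<leftarrow>as. tilted_var S (\<lambda>s. z s + u * b s) a) - (\<Sum>a\<leftarrow>as. tilted_var S z a)\<bar> \<le> D * \<bar>u\<bar>"
proof (induction as)
  case (Cons a as)
  then obtain D where D: "\<And>z u. \<bar>(\<Sum>a\<leftarrow>as. tilted_var S (\<lambda>s. z s + u * b s) a) - (\<Sum>a\<leftarrow>as. tilted_var S z a)\<bar> \<le> D * \<bar>u\<bar>"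
    by blast
  obtain A B where AB: "\<And>s. s \<in> S \<Longrightarrow> \<bar>a s\<bar> \<le> A" "\<And>s. s \<in> S \<Longrightarrow> \<bar>b s\<bar> \<le> B"
    using bounded_on_finite[of a] bounded_on_finite[of b] by blast
  have "\<bar>tilted_var S (\<lambda>s. z s + u * b s) a - tilted_var S z a\<bar> \<le> 6 * A\<^sup>2 * B * \<bar>u\<bar>" for z u
    by (rule tilted_var_lipschitz[OF S AB])
  then have "\<bar>(\<Sum>a\<leftarrow>a # as. tilted_var S (\<lambda>s. z s + u * b s) a) - (\<Sum>a\<leftarrow>a # as. tilted_var S z a)\<bar>
      \<le> (6 * A\<^sup>2 * B + D) * \<bar>u\<bar>" for z u
    using abs_triangle_ineq[of "tilted_var S (\<lambda>s. z s + u * b s) a - tilted_var S z a"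
        "(\<Sum>a\<leftarrow>as. tilted_var S (\<lambda>s. z s + u * b s) a) - (\<Sum>a\<leftarrow>as. tilted_var S z a)"]
      add_mono[OF _ D[of z u]]
    by (simp add: distrib_right add_diff_add) (meson order_trans)
  then show ?case by blast
qed (intro exI[of _ 0], simp)

text \<open>A shift by \<open>x * (r * b s)\<close> changes the sum of tilted variances by order
  \<open>r\<close>; after the factor \<open>r\<^sup>2 / 2\<close> this is again a cubic error.
  \<open>C\<close> is chosen before \<open>r\<close> and \<open>z\<close>, as iterating the step
  requires.\<close>

lemma gauss_avgs_lse_Taylor:
  "\<exists>C. \<forall>r\<ge>0. \<forall>z. \<bar>gauss_avgs (map (\<lambda>a s. r * a s) as) (lse S) z
      - (lse S z + r\<^sup>2 / 2 * (\<Sum>a\<leftarrow>as. tilted_var S z a))\<bar> \<le> C * r ^ 3"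
proof (induction as)
  case (Cons b as)
  then obtain C where C: "\<And>r z. r \<ge> 0 \<Longrightarrow> \<bar>gauss_avgs (map (\<lambda>a s. r * a s) as) (lse S) z
      - (lse S z + r\<^sup>2 / 2 * (\<Sum>a\<leftarrow>as. tilted_var S z a))\<bar> \<le> C * r ^ 3"
    by blast
  obtain D where D: "\<And>z u. \<bar>(\<Sum>a\<leftarrow>as. tilted_var S (\<lambda>s. z s + u * b s) a) - (\<Sum>a\<leftarrow>as. tilted_var S z a)\<bar> \<le> D * \<bar>u\<bar>"
    using sum_list_tilted_var_lipschitz by blast
  obtain B where B: "\<And>s. s \<in> S \<Longrightarrow> \<bar>b s\<bar> \<le> B"
    using bounded_on_finite[of b] by blast
  \<comment> \<open>\<open>C\<close> is the error of the remaining directions, \<open>D / 2\<close>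
    comes from freezing their tilted variances at \<open>z\<close>, and \<open>B ^ 3\<close> is the
    Taylor remainder in the new direction.\<close>
  let ?C = "C + D / 2 * (\<integral>x. \<bar>x\<bar> \<partial>std_normal_distribution)
        + B ^ 3 * (\<integral>x. \<bar>x\<bar> ^ 3 \<partial>std_normal_distribution)"
  have "\<bar>gauss_avgs (map (\<lambda>a s. r * a s) (b # as)) (lse S) z
      - (lse S z + r\<^sup>2 / 2 * (\<Sum>a\<leftarrow>b # as. tilted_var S z a))\<bar> \<le> ?C * r ^ 3" if r: "r \<ge> 0" for r z
  proof -
    define G where "G = gauss_avgs (map (\<lambda>a s. r * a s) as) (lse S)"
    define V where "V = (\<lambda>z. \<Sum>a\<leftarrow>as. tilted_var S z a)"
    have "\<bar>G (\<lambda>s. z s + x * (r * b s)) - (lse S (\<lambda>s. z s + x * (r * b s)) + r\<^sup>2 / 2 * V z)\<bar> \<le> r ^ 3 * (C + D / 2 * \<bar>x\<bar>)" for x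
    proof -
      let ?w = "\<lambda>s. z s + x * (r * b s)"
      have "\<bar>V ?w - V z\<bar> \<le> D * (r * \<bar>x\<bar>)"
        using D[of z "x * r"] r by (simp add: V_def mult.assoc abs_mult mult.left_commute mult.commute)
      then have "r\<^sup>2 / 2 * \<bar>V ?w - V z\<bar> \<le> r\<^sup>2 / 2 * (D * (r * \<bar>x\<bar>))"
        by (intro mult_left_mono) auto
      then have "\<bar>r\<^sup>2 / 2 * V ?w - r\<^sup>2 / 2 * V z\<bar> \<le> r\<^sup>2 / 2 * (D * (r * \<bar>x\<bar>))"
        unfolding right_diff_distrib[symmetric] by (simp add: abs_mult)
      moreover have "\<bar>G ?w - (lse S ?w + r\<^sup>2 / 2 * V ?w)\<bar> \<le> C * r ^ 3"
        using C[OF r, of ?w] by (simp add: G_def V_def)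
      ultimately have "\<bar>G ?w - (lse S ?w + r\<^sup>2 / 2 * V z)\<bar> \<le> C * r ^ 3 + r\<^sup>2 / 2 * (D * (r * \<bar>x\<bar>))"
        by linarith
      also have "\<dots> = r ^ 3 * (C + D / 2 * \<bar>x\<bar>)"
        by (simp add: algebra_simps power2_eq_square power3_eq_cube)
      finally show ?thesis .
    qed
    moreover have "lipschitz_coords S (\<lambda>_. 1) G"
      unfolding G_def by (intro lipschitz_coords_gauss_avgs lipschitz_coords_lse S)
    ultimately have "\<bar>gauss_avg (\<lambda>s. r * b s) G z - (lse S z + r\<^sup>2 / 2 * V z + r\<^sup>2 / 2 * tilted_var S z b)\<bar>
        \<le> r ^ 3 * ?C"
      by (intro gauss_avg_lse_Taylor B r)
    then show ?thesis
      by (simp add: G_def V_def algebra_simps del: integral_std_normal_abs)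
  qed
  then show ?case by blast
qed (intro exI[of _ 0], simp)

text \<open>Only covariances of the process enter: the variances with a positive sign, the
  covariances of all pairs with a negative one. With equal variances, larger covariances therefore
  give a smaller second-order term, which fixes the direction of Slepian's inequality.\<close>

lemma sum_list_tilted_var:
  "(\<Sum>a\<leftarrow>as. tilted_var S z a) =
    (\<Sum>s\<in>S. exp (z s) * (\<Sum>a\<leftarrow>as. (a s)\<^sup>2)) / (\<Sum>s\<in>S. exp (z s))
    - (\<Sum>s\<in>S. \<Sum>t\<in>S. exp (z s) * exp (z t) * (\<Sum>a\<leftarrow>as. a s * a t)) / (\<Sum>s\<in>S. exp (z s))\<^sup>2"
proof (induction as)
  case (Cons a as)
  have "tilted_var S z a = (\<Sum>s\<in>S. exp (z s) * (a s)\<^sup>2) / (\<Sum>s\<in>S. exp (z s))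
     - (\<Sum>s\<in>S. \<Sum>t\<in>S. exp (z s) * exp (z t) * (a s * a t)) / (\<Sum>s\<in>S. exp (z s))\<^sup>2"
    unfolding tilted_var_def tilted_mean_def power_divide
    by (simp add: power2_eq_square sum_product mult_ac)
  with Cons show ?case
    by (simp add: distrib_left sum.distrib add_divide_distrib)
qed simp

lemma gauss_avgs_lse_mono:
  assumes var: "\<And>s. s \<in> S \<Longrightarrow> (\<Sum>a\<leftarrow>as. (a s)\<^sup>2) = (\<Sum>b\<leftarrow>bs. (b s)\<^sup>2)"
    and cov: "\<And>s t. s \<in> S \<Longrightarrow> t \<in> S \<Longrightarrow> (\<Sum>a\<leftarrow>as. a s * a t) \<le> (\<Sum>b\<leftarrow>bs. b s * b t)"
  shows "gauss_avgs bs (lse S) z \<le> gauss_avgs as (lse S) z"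
proof -
  have tv: "(\<Sum>b\<leftarrow>bs. tilted_var S z b) \<le> (\<Sum>a\<leftarrow>as. tilted_var S z a)" for z
    unfolding sum_list_tilted_var
    by (intro diff_mono divide_right_mono sum_mono mult_left_mono cov) (simp_all add: var sum_nonneg)
  obtain C where C: "\<And>r z. r \<ge> 0 \<Longrightarrow> \<bar>gauss_avgs (map (\<lambda>a s. r * a s) as) (lse S) z
      - (lse S z + r\<^sup>2 / 2 * (\<Sum>a\<leftarrow>as. tilted_var S z a))\<bar> \<le> C * r ^ 3"
    using gauss_avgs_lse_Taylor by blast
  obtain D where D: "\<And>r z. r \<ge> 0 \<Longrightarrow> \<bar>gauss_avgs (map (\<lambda>a s. r * a s) bs) (lse S) z
      - (lse S z + r\<^sup>2 / 2 * (\<Sum>a\<leftarrow>bs. tilted_var S z a))\<bar> \<le> D * r ^ 3"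
    using gauss_avgs_lse_Taylor by blast
  note lip = lipschitz_coords_lse[OF S]
  have main: "gauss_avgs bs (lse S) z \<le> gauss_avgs as (lse S) z + (C + D) / sqrt (real (Suc n))" for n
  proof -
    define N where "N = Suc n"
    define r where "r = 1 / sqrt (real N)"
    have r: "r \<ge> 0" by (simp add: r_def)
    have step: "gauss_avgs (map (\<lambda>a s. r * a s) bs) (lse S) z
        \<le> gauss_avgs (map (\<lambda>a s. r * a s) as) (lse S) z + (C + D) * r ^ 3" for z
    proof -
      have "r\<^sup>2 / 2 * (\<Sum>b\<leftarrow>bs. tilted_var S z b) \<le> r\<^sup>2 / 2 * (\<Sum>a\<leftarrow>as. tilted_var S z a)"
        by (intro mult_left_mono tv) simp
      with C[OF r, of z] D[OF r, of z] show ?thesis by (simp add: distrib_right)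
    qed
    have "gauss_avgs bs (lse S) z \<le> gauss_avgs as (lse S) z + real N * ((C + D) * r ^ 3)"
      using gauss_avgs_funpow_mono[OF lip step, of N z]
      unfolding r_def by (subst (asm) (1 2) gauss_avgs_divide[OF lip]) (simp_all add: N_def)
    also have "real N * ((C + D) * r ^ 3) = (C + D) * r"
    proof -
      have "real N * r\<^sup>2 = 1" by (simp add: r_def N_def power_divide)
      then show ?thesis by (simp add: power3_eq_cube power2_eq_square)
    qed
    finally show ?thesis by (simp add: r_def N_def)
  qed
  have "(\<lambda>n. gauss_avgs as (lse S) z + (C + D) / sqrt (real (Suc n))) \<longlonglongrightarrow> gauss_avgs as (lse S) z + 0"
    by (intro tendsto_add tendsto_const LIMSEQ_Suc[OF real_tendsto_divide_at_top[OF tendsto_const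
         filterlim_compose[OF sqrt_at_top filterlim_real_sequentially]]])
  then show ?thesis
    using main by (intro LIMSEQ_le_const) auto
qed

section \<open>From log-sum-exp to the maximum\<close>

lemma lipschitz_coords_Max: "lipschitz_coords S (\<lambda>_. 1) (\<lambda>z. Max (z ` S))"
proof -
  have *: "Max (z ` S) \<le> Max (w ` S) + (\<Sum>s\<in>S. \<bar>z s - w s\<bar>)" for z w :: "'s \<Rightarrow> real"
  proof -
    have "z s \<le> Max (w ` S) + (\<Sum>s\<in>S. \<bar>z s - w s\<bar>)" if "s \<in> S" for s
    proof -
      have "\<bar>z s - w s\<bar> \<le> (\<Sum>s\<in>S. \<bar>z s - w s\<bar>)" "w s \<le> Max (w ` S)"
        using S that by (auto intro!: member_le_sum[where f="\<lambda>s. \<bar>z s - w s\<bar>"])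
      then show ?thesis by linarith
    qed
    then show ?thesis using S by simp
  qed
  show ?thesis
    unfolding lipschitz_coords_def
  proof (intro allI)
    fix z w :: "'s \<Rightarrow> real"
    show "\<bar>Max (z ` S) - Max (w ` S)\<bar> \<le> (\<Sum>s\<in>S. 1 * \<bar>z s - w s\<bar>)"
      using *[of z w] *[of w z] by (simp add: abs_minus_commute abs_le_iff)
  qed
qed

lemma Max_image_mult:
  assumes "\<beta> \<ge> (0 :: real)"
  shows "Max ((\<lambda>s. \<beta> * z s) ` S) = \<beta> * Max (z ` S)"
proof -
  have "mono (\<lambda>x. \<beta> * x)" using assms by (intro monoI mult_left_mono)
  from mono_Max_commute[OF this, of "z ` S"] S show ?thesis by (simp add: image_image)
qed

end

lemma gauss_avgs_homogeneous:
  assumes "\<And>z. F (\<lambda>s. \<beta> * z s) = \<beta> * F z"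
  shows "gauss_avgs (map (\<lambda>a s. \<beta> * a s) as) F (\<lambda>s. \<beta> * z s) = \<beta> * gauss_avgs as F z"
proof (induction as arbitrary: z)
  case (Cons a as)
  have "\<beta> * z s + x * (\<beta> * a s) = \<beta> * (z s + x * a s)" for x s
    by (simp add: algebra_simps)
  with Cons show ?case
    by (simp add: gauss_avg_def)
qed (use assms in simp)

text \<open>The additive error \<open>ln (card S)\<close> of \<open>lse\<close> against \<open>Max\<close> disappears when both families
  are scaled by a large factor.\<close>

lemma gauss_avgs_Max_mono:
  assumes S: "finite S" "S \<noteq> {}"
    and var: "\<And>s. s \<in> S \<Longrightarrow> (\<Sum>a\<leftarrow>as. (a s)\<^sup>2) = (\<Sum>b\<leftarrow>bs. (b s)\<^sup>2)"
    and cov: "\<And>s t. s \<in> S \<Longrightarrow> t \<in> S \<Longrightarrow> (\<Sum>a\<leftarrow>as. a s * a t) \<le> (\<Sum>b\<leftarrow>bs. b s * b t)"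
  shows "gauss_avgs bs (\<lambda>z. Max (z ` S)) (\<lambda>_. 0) \<le> gauss_avgs as (\<lambda>z. Max (z ` S)) (\<lambda>_. 0)"
proof -
  let ?M = "\<lambda>z. Max (z ` S) :: real"
  note lipM = lipschitz_coords_Max[OF S] and lipL = lipschitz_coords_lse[OF S]
  have main: "gauss_avgs bs ?M (\<lambda>_. 0) \<le> gauss_avgs as ?M (\<lambda>_. 0) + ln (real (card S)) / real (Suc n)" for n
  proof -
    define \<beta> where "\<beta> = real (Suc n)"
    have \<beta>: "\<beta> > 0" by (simp add: \<beta>_def)
    let ?sc = "map (\<lambda>a s. \<beta> * a s)"
    have hom: "gauss_avgs (?sc xs) ?M (\<lambda>_. 0) = \<beta> * gauss_avgs xs ?M (\<lambda>_. 0)" for xs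
      using gauss_avgs_homogeneous[of ?M \<beta> xs "\<lambda>_. 0"] Max_image_mult[OF S] \<beta> by simp
    have scs: "(\<Sum>a\<leftarrow>?sc xs. a s * a t) = \<beta>\<^sup>2 * (\<Sum>a\<leftarrow>xs. a s * a t)" for xs and s t :: 's
      by (induction xs) (simp_all add: algebra_simps power2_eq_square)
    have "\<beta> * gauss_avgs bs ?M (\<lambda>_. 0) = gauss_avgs (?sc bs) ?M (\<lambda>_. 0)"
      by (simp only: hom)
    also have "\<dots> \<le> gauss_avgs (?sc bs) (lse S) (\<lambda>_. 0)"
      using Max_le_lse[OF S] gauss_avgs_mono[OF lipM lipL, of 0] by simp
    also have "\<dots> \<le> gauss_avgs (?sc as) (lse S) (\<lambda>_. 0)"
    proof -
      have cov': "(\<Sum>a\<leftarrow>?sc as. a s * a t) \<le> (\<Sum>a\<leftarrow>?sc bs. a s * a t)" if "s \<in> S" "t \<in> S" for s t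
        unfolding scs using cov that by (intro mult_left_mono) auto
      have var': "(\<Sum>a\<leftarrow>?sc as. (a s)\<^sup>2) = (\<Sum>a\<leftarrow>?sc bs. (a s)\<^sup>2)" if "s \<in> S" for s
        using scs[of s s] var[OF that] by (simp only: power2_eq_square)
      show ?thesis by (rule gauss_avgs_lse_mono[OF S var' cov'])
    qed
    also have "\<dots> \<le> gauss_avgs (?sc as) ?M (\<lambda>_. 0) + ln (real (card S))"
      using lse_le_Max[OF S] by (intro gauss_avgs_mono[OF lipL lipM])
    also have "\<dots> = \<beta> * gauss_avgs as ?M (\<lambda>_. 0) + ln (real (card S))"
      by (simp only: hom)
    finally have "gauss_avgs bs ?M (\<lambda>_. 0) \<le> (\<beta> * gauss_avgs as ?M (\<lambda>_. 0) + ln (real (card S))) / \<beta>"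
      using \<beta> by (simp add: pos_le_divide_eq mult.commute)
    then show ?thesis using \<beta> by (simp add: add_divide_distrib \<beta>_def)
  qed
  have "(\<lambda>n. gauss_avgs as ?M (\<lambda>_. 0) + ln (real (card S)) / real (Suc n)) \<longlonglongrightarrow> gauss_avgs as ?M (\<lambda>_. 0) + 0"
    by (intro tendsto_add tendsto_const LIMSEQ_Suc[OF lim_const_over_n])
  then show ?thesis
    using main by (intro LIMSEQ_le_const) auto
qed

subsection \<open>Slepian's inequality for expected maxima\<close>

lemma integrable_PiM_std_normal_component:
  fixes h :: "real \<Rightarrow> real"
  assumes "k \<in> I" "integrable std_normal_distribution h"
  shows "integrable (PiM I (\<lambda>_. std_normal_distribution)) (\<lambda>g. h (g k))"
    and "(\<integral>g. h (g k) \<partial>PiM I (\<lambda>_. std_normal_distribution)) = (\<integral>x. h x \<partial>std_normal_distribution)"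
proof -
  have eq: "distr (PiM I (\<lambda>_. std_normal_distribution)) std_normal_distribution (\<lambda>g. g k) = std_normal_distribution"
    using distr_PiM_component[of I "\<lambda>_. std_normal_distribution" k] assms(1)
      prob_space_std_normal_distribution by simp
  have [measurable]: "(\<lambda>g. g k) \<in> measurable (PiM I (\<lambda>_. std_normal_distribution)) std_normal_distribution"
    using assms(1) by (rule measurable_component_singleton)
  show "integrable (PiM I (\<lambda>_. std_normal_distribution)) (\<lambda>g. h (g k))"
    by (rule integrable_distr[where M'=std_normal_distribution]) (use assms in \<open>simp_all add: eq\<close>)
  show "(\<integral>g. h (g k) \<partial>PiM I (\<lambda>_. std_normal_distribution)) = (\<integral>x. h x \<partial>std_normal_distribution)"
    using integral_distr[of "\<lambda>g. g k" "PiM I (\<lambda>_. std_normal_distribution)" std_normal_distribution h] borel_measurable_integrable[OF assms(2)] assms(1)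
    by (simp add: eq)
qed

lemma prob_space_PiM_std_normal: "prob_space (PiM I (\<lambda>_. std_normal_distribution))"
  by (intro prob_space_PiM prob_space_std_normal_distribution)

lemma lipschitz_coords_bound:
  assumes "lipschitz_coords I c f"
  shows "\<bar>f g\<bar> \<le> \<bar>f (\<lambda>_. 0)\<bar> + (\<Sum>k\<in>I. c k * \<bar>g k\<bar>)"
  using lipschitz_coordsD[OF assms, of g "\<lambda>_. 0"] by simp

lemma integrable_PiM_lipschitz:
  assumes "f \<in> borel_measurable (PiM I (\<lambda>_. std_normal_distribution))" "lipschitz_coords I c f"
  shows "integrable (PiM I (\<lambda>_. std_normal_distribution)) f"
proof -
  interpret prob_space "PiM I (\<lambda>_. std_normal_distribution)" by (rule prob_space_PiM_std_normal)
  have "integrable (PiM I (\<lambda>_. std_normal_distribution)) (\<lambda>g. \<bar>g k\<bar>)" if "k \<in> I" for k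
    using integrable_PiM_std_normal_component(1)[OF that integrable_std_normal_abs] .
  then have "integrable (PiM I (\<lambda>_. std_normal_distribution)) (\<lambda>g. \<bar>f (\<lambda>_. 0)\<bar> + (\<Sum>k\<in>I. c k * \<bar>g k\<bar>))"
    by (intro Bochner_Integration.integrable_add Bochner_Integration.integrable_sum integrable_mult_right) simp_all
  moreover have "norm (f g) \<le> norm (\<bar>f (\<lambda>_. 0)\<bar> + (\<Sum>k\<in>I. c k * \<bar>g k\<bar>))" for g
    using lipschitz_coords_bound[OF assms(2), of g] by simp
  ultimately show ?thesis
    using Bochner_Integration.integrable_bound[OF _ assms(1) AE_I2] by blast
qed

lemma lipschitz_coords_linear:
  assumes F: "lipschitz_coords S c F"
  shows "lipschitz_coords I (\<lambda>k. \<Sum>s\<in>S. \<bar>c s\<bar> * \<bar>a k s\<bar>) (\<lambda>g. F (\<lambda>s. z s + (\<Sum>k\<in>I. g k * a k s)))"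
  unfolding lipschitz_coords_def
proof (intro allI)
  fix g h :: "_ \<Rightarrow> real"
  have "\<bar>F (\<lambda>s. z s + (\<Sum>k\<in>I. g k * a k s)) - F (\<lambda>s. z s + (\<Sum>k\<in>I. h k * a k s))\<bar>
      \<le> (\<Sum>s\<in>S. c s * \<bar>\<Sum>k\<in>I. (g k - h k) * a k s\<bar>)"
    using lipschitz_coordsD[OF F, of "\<lambda>s. z s + (\<Sum>k\<in>I. g k * a k s)" "\<lambda>s. z s + (\<Sum>k\<in>I. h k * a k s)"]
    by (simp add: sum_subtractf[symmetric] left_diff_distrib)
  also have "\<dots> \<le> (\<Sum>s\<in>S. \<bar>c s\<bar> * (\<Sum>k\<in>I. \<bar>g k - h k\<bar> * \<bar>a k s\<bar>))"
    by (intro sum_mono mult_mono sum_abs[THEN order_trans]) (auto simp: abs_mult)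
  also have "\<dots> = (\<Sum>k\<in>I. (\<Sum>s\<in>S. \<bar>c s\<bar> * \<bar>a k s\<bar>) * \<bar>g k - h k\<bar>)"
    by (simp add: sum_distrib_left sum_distrib_right mult_ac) (rule sum.swap)
  finally show "\<bar>F (\<lambda>s. z s + (\<Sum>k\<in>I. g k * a k s)) - F (\<lambda>s. z s + (\<Sum>k\<in>I. h k * a k s))\<bar>
      \<le> (\<Sum>k\<in>I. (\<Sum>s\<in>S. \<bar>c s\<bar> * \<bar>a k s\<bar>) * \<bar>g k - h k\<bar>)" .
qed

text \<open>The link between iterated averages and expectations over a product space. The average
  over the head index is commuted to the innermost place, so the induction hypothesis is used for
  the averaged function, and \<open>F\<close> has to be arbitrary. Measurability is carried along
  because \<open>F\<close> lives on a function space without a sigma-algebra.\<close>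

lemma gauss_avgs_eq_integral_PiM:
  assumes "lipschitz_coords S c F" "distinct ks"
    and "(\<lambda>g. F (\<lambda>s. z s + (\<Sum>k\<in>set ks. g k * a k s))) \<in> borel_measurable (PiM (set ks) (\<lambda>_. std_normal_distribution))"
  shows "gauss_avgs (map a ks) F z
    = (\<integral>g. F (\<lambda>s. z s + (\<Sum>k\<in>set ks. g k * a k s)) \<partial>PiM (set ks) (\<lambda>_. std_normal_distribution))"
  using assms
proof (induction ks arbitrary: F)
  case Nil
  show ?case by (simp add: prob_space.prob_space[OF prob_space_PiM_std_normal])
next
  case (Cons k ks)
  let ?N = std_normal_distribution
  let ?L = "\<lambda>I g s. z s + (\<Sum>k\<in>I. g k * a k s)"
  have k: "k \<notin> set ks" and d: "distinct ks" using Cons.prems by auto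
  have upd: "?L (insert k (set ks)) (g(k := x)) s = ?L (set ks) g s + x * a k s" for g x s
  proof -
    have "(\<Sum>j\<in>set ks. (g(k := x)) j * a j s) = (\<Sum>j\<in>set ks. g j * a j s)"
      using k by (intro sum.cong) auto
    then show ?thesis using k by simp
  qed
  have "(\<lambda>(g, x). F (?L (insert k (set ks)) (g(k := x)))) \<in> borel_measurable (PiM (set ks) (\<lambda>_. ?N) \<Otimes>\<^sub>M ?N)"
    using measurable_compose[OF measurable_add_dim Cons.prems(3)[unfolded list.set]]
    by (simp add: case_prod_unfold)
  then have meas: "(\<lambda>g. gauss_avg (a k) F (?L (set ks) g)) \<in> borel_measurable (PiM (set ks) (\<lambda>_. ?N))"
    unfolding gauss_avg_def upd by (rule std_normal.borel_measurable_lebesgue_integral)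
  have "gauss_avgs (map a (k # ks)) F z = gauss_avgs (map a ks) (gauss_avg (a k) F) z"
    by (simp add: gauss_avg_gauss_avgs_commute[OF Cons.prems(1)])
  also have "\<dots> = (\<integral>g. gauss_avg (a k) F (?L (set ks) g) \<partial>PiM (set ks) (\<lambda>_. ?N))"
    by (rule Cons.IH[OF lipschitz_coords_gauss_avg[OF Cons.prems(1)] d meas])
  also have "\<dots> = (\<integral>g. \<integral>x. F (?L (insert k (set ks)) (g(k := x))) \<partial>?N \<partial>PiM (set ks) (\<lambda>_. ?N))"
    unfolding upd gauss_avg_def ..
  also have "\<dots> = (\<integral>g. F (?L (insert k (set ks)) g) \<partial>PiM (insert k (set ks)) (\<lambda>_. ?N))"
    by (rule std_normal_PiM.product_integral_insert[symmetric, OF _ k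
          integrable_PiM_lipschitz[OF Cons.prems(3)[unfolded list.set] lipschitz_coords_linear[OF Cons.prems(1)]]]) simp
  finally show ?case by simp
qed

lemma Max_Times_add:
  fixes f :: "'u \<Rightarrow> real" and g :: "'v \<Rightarrow> real"
  assumes "finite U" "U \<noteq> {}" "finite V" "V \<noteq> {}"
  shows "Max ((\<lambda>p. f (fst p) + g (snd p)) ` (U \<times> V)) = Max (f ` U) + Max (g ` V)"
proof (rule Max_eqI)
  have "Max (f ` U) \<in> f ` U" "Max (g ` V) \<in> g ` V" using assms by auto
  then obtain u v where "u \<in> U" "v \<in> V" "Max (f ` U) = f u" "Max (g ` V) = g v" by auto
  then show "Max (f ` U) + Max (g ` V) \<in> (\<lambda>p. f (fst p) + g (snd p)) ` (U \<times> V)"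
    by (auto intro!: image_eqI[of _ _ "(u, v)"])
qed (use assms in \<open>auto intro!: add_mono\<close>)

text \<open>Common form of the bilinear and the quadratic maximum: \<open>I\<close> will be a set of
  index pairs, \<open>g\<close> the matrix entries, and \<open>a\<close> their coefficients in the
  form.\<close>

definition gauss_Max :: "'k set \<Rightarrow> ('k \<Rightarrow> 's \<Rightarrow> real) \<Rightarrow> 's set \<Rightarrow> ('k \<Rightarrow> real) \<Rightarrow> real" where
  "gauss_Max I a S g = Max ((\<lambda>s. \<Sum>k\<in>I. g k * a k s) ` S)"

definition E_gauss_Max :: "'k set \<Rightarrow> ('k \<Rightarrow> 's \<Rightarrow> real) \<Rightarrow> 's set \<Rightarrow> real" where
  "E_gauss_Max I a S = (\<integral>g. gauss_Max I a S g \<partial>PiM I (\<lambda>_. std_normal_distribution))"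

lemma measurable_gauss_Max [measurable]:
  assumes "finite S" "finite I"
  shows "(\<lambda>g. Max ((\<lambda>s. z s + (\<Sum>k\<in>I. g k * a k s)) ` S)) \<in> borel_measurable (PiM I (\<lambda>_. std_normal_distribution))"
    and "gauss_Max I a S \<in> borel_measurable (PiM I (\<lambda>_. std_normal_distribution))"
proof -
  have *: "(\<lambda>g. z s + (\<Sum>k\<in>I. g k * a k s)) \<in> borel_measurable (PiM I (\<lambda>_. std_normal_distribution))" for z :: "_ \<Rightarrow> real" and s
  proof -
    have [measurable]: "(\<lambda>g. g k) \<in> borel_measurable (PiM I (\<lambda>_. std_normal_distribution))" if "k \<in> I" for k
      using measurable_component_singleton[OF that, of "\<lambda>_. std_normal_distribution"] by simp
    show ?thesis by measurable
  qed
  show 1: "(\<lambda>g. Max ((\<lambda>s. z s + (\<Sum>k\<in>I. g k * a k s)) ` S)) \<in> borel_measurable (PiM I (\<lambda>_. std_normal_distribution))" for z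
    by (rule borel_measurable_Max[OF assms(1) *])
  show "gauss_Max I a S \<in> borel_measurable (PiM I (\<lambda>_. std_normal_distribution))"
    using 1[of "\<lambda>_. 0"] by (simp add: gauss_Max_def[abs_def])
qed

text \<open>A maximum of linear functions varies in each coordinate at most as fast as its steepest
  member. For sign vectors these constants are small enough to give variance at most one.\<close>

lemma lipschitz_coords_gauss_Max:
  assumes S: "finite S" "S \<noteq> {}" and c: "\<And>k s. k \<in> I \<Longrightarrow> s \<in> S \<Longrightarrow> \<bar>a k s\<bar> \<le> c k"
  shows "lipschitz_coords I c (gauss_Max I a S)"
proof -
  have *: "gauss_Max I a S g \<le> gauss_Max I a S h + (\<Sum>k\<in>I. c k * \<bar>g k - h k\<bar>)" for g h
  proof -
    have "(\<Sum>k\<in>I. g k * a k s) \<le> gauss_Max I a S h + (\<Sum>k\<in>I. c k * \<bar>g k - h k\<bar>)" if s: "s \<in> S" for s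
    proof -
      have "(\<Sum>k\<in>I. g k * a k s) \<le> (\<Sum>k\<in>I. h k * a k s + c k * \<bar>g k - h k\<bar>)"
      proof (rule sum_mono)
        fix k assume k: "k \<in> I"
        have "(g k - h k) * a k s \<le> \<bar>g k - h k\<bar> * \<bar>a k s\<bar>"
          by (metis abs_ge_self abs_mult)
        also have "\<dots> \<le> \<bar>g k - h k\<bar> * c k" using c[OF k s] by (intro mult_left_mono) auto
        finally show "g k * a k s \<le> h k * a k s + c k * \<bar>g k - h k\<bar>" by (simp add: algebra_simps)
      qed
      also have "\<dots> \<le> gauss_Max I a S h + (\<Sum>k\<in>I. c k * \<bar>g k - h k\<bar>)"
        using S s by (simp add: sum.distrib gauss_Max_def)
      finally show ?thesis .
    qed
    then show ?thesis using S by (simp add: gauss_Max_def[of I a S g])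
  qed
  show ?thesis
    unfolding lipschitz_coords_def
  proof (intro allI)
    fix g h
    show "\<bar>gauss_Max I a S g - gauss_Max I a S h\<bar> \<le> (\<Sum>k\<in>I. c k * \<bar>g k - h k\<bar>)"
      using *[of g h] *[of h g] by (simp add: abs_minus_commute abs_le_iff)
  qed
qed

lemma integrable_gauss_Max:
  assumes "finite S" "S \<noteq> {}" "finite I"
  shows "integrable (PiM I (\<lambda>_. std_normal_distribution)) (gauss_Max I a S)"
  by (rule integrable_PiM_lipschitz[OF measurable_gauss_Max(2)
        lipschitz_coords_gauss_Max[where c="\<lambda>k. \<Sum>s\<in>S. \<bar>a k s\<bar>"]])
     (use assms in \<open>auto intro!: member_le_sum[where f="\<lambda>s. \<bar>a _ s\<bar>"]\<close>)

text \<open>On the smaller side stands a sum of independent processes, one in each component of the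
  index. Its maximum over the product set separates, so its mean is a sum of two expected
  maxima.\<close>

lemma E_gauss_Max_Slepian:
  fixes a :: "'i \<Rightarrow> 'u \<times> 'v \<Rightarrow> real" and b :: "'j \<Rightarrow> 'u \<Rightarrow> real" and c :: "'k \<Rightarrow> 'v \<Rightarrow> real"
  assumes U: "finite U" "U \<noteq> {}" and V: "finite V" "V \<noteq> {}"
    and fin: "finite I" "finite J" "finite K"
    and var: "\<And>x y. x \<in> U \<Longrightarrow> y \<in> V \<Longrightarrow>
      (\<Sum>i\<in>I. (a i (x, y))\<^sup>2) = (\<Sum>j\<in>J. (b j x)\<^sup>2) + (\<Sum>k\<in>K. (c k y)\<^sup>2)"
    and cov: "\<And>x y x' y'. x \<in> U \<Longrightarrow> y \<in> V \<Longrightarrow> x' \<in> U \<Longrightarrow> y' \<in> V \<Longrightarrow>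
      (\<Sum>i\<in>I. a i (x, y) * a i (x', y')) \<le> (\<Sum>j\<in>J. b j x * b j x') + (\<Sum>k\<in>K. c k y * c k y')"
  shows "E_gauss_Max J b U + E_gauss_Max K c V \<le> E_gauss_Max I a (U \<times> V)"
proof -
  let ?N = std_normal_distribution
  let ?S = "U \<times> V"
  let ?M = "\<lambda>z. Max (z ` ?S) :: real"
  have S: "finite ?S" "?S \<noteq> {}" using U V by auto
  note lip = lipschitz_coords_Max[OF S]
  obtain is' js ks where lists: "set is' = I" "distinct is'" "set js = J" "distinct js" "set ks = K" "distinct ks"
    using fin finite_distinct_list by metis
  define as where "as = map a is'"
  define bs where "bs = map (\<lambda>j (p :: 'u \<times> 'v). b j (fst p)) js"
  define cs where "cs = map (\<lambda>k (p :: 'u \<times> 'v). c k (snd p)) ks"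
  have "gauss_avgs (bs @ cs) ?M (\<lambda>_. 0) \<le> gauss_avgs as ?M (\<lambda>_. 0)"
    using var cov
    by (intro gauss_avgs_Max_mono[OF S])
       (auto simp: as_def bs_def cs_def sum_list_distinct_conv_sum_set comp_def lists)
  moreover have "gauss_avgs as ?M (\<lambda>_. 0) = E_gauss_Max I a ?S"
    using gauss_avgs_eq_integral_PiM[OF lip lists(2), of "\<lambda>_. 0" a] measurable_gauss_Max(2)[OF S(1) fin(1), of a]
    by (simp add: lists as_def E_gauss_Max_def gauss_Max_def[abs_def])
  \<comment> \<open>\<open>w\<close> stands for the value accumulated from the \<open>b\<close>
    directions. It depends on the first component only, so the maximum splits before the expectation
    over \<open>c\<close> is taken.\<close>
  moreover have C: "gauss_avgs cs ?M (\<lambda>p. w (fst p)) = Max (w ` U) + E_gauss_Max K c V" for w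
  proof -
    have "gauss_avgs cs ?M (\<lambda>p. w (fst p)) = (\<integral>g. Max ((\<lambda>p. w (fst p) + (\<Sum>k\<in>K. g k * c k (snd p))) ` ?S) \<partial>PiM K (\<lambda>_. ?N))"
      using gauss_avgs_eq_integral_PiM[OF lip lists(6), of "\<lambda>p. w (fst p)" "\<lambda>k p. c k (snd p)"]
        measurable_gauss_Max(1)[OF S(1) fin(3), of "\<lambda>p. w (fst p)" "\<lambda>k p. c k (snd p)"]
      by (simp add: lists cs_def)
    also have "\<dots> = (\<integral>g. Max (w ` U) + gauss_Max K c V g \<partial>PiM K (\<lambda>_. ?N))"
      unfolding gauss_Max_def by (subst Max_Times_add[OF U V]) simp
    also have "\<dots> = Max (w ` U) + E_gauss_Max K c V"
    proof -
      interpret prob_space "PiM K (\<lambda>_. ?N)" by (rule prob_space_PiM_std_normal)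
      show ?thesis
        unfolding E_gauss_Max_def using prob_space
        by (subst Bochner_Integration.integral_add) (simp_all add: integrable_gauss_Max[OF V fin(3)])
    qed
    finally show ?thesis .
  qed
  moreover have "gauss_avgs bs (gauss_avgs cs ?M) (\<lambda>_. 0) = E_gauss_Max J b U + E_gauss_Max K c V"
  proof -
    interpret prob_space "PiM J (\<lambda>_. ?N)" by (rule prob_space_PiM_std_normal)
    have eq: "gauss_avgs cs ?M (\<lambda>p. 0 + (\<Sum>k\<in>J. g k * b k (fst p))) = gauss_Max J b U g + E_gauss_Max K c V" for g
      using C[of "\<lambda>u. \<Sum>k\<in>J. g k * b k u"] by (simp add: gauss_Max_def)
    have "gauss_avgs bs (gauss_avgs cs ?M) (\<lambda>_. 0)
        = (\<integral>g. gauss_avgs cs ?M (\<lambda>p. 0 + (\<Sum>k\<in>J. g k * b k (fst p))) \<partial>PiM J (\<lambda>_. ?N))"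
      unfolding bs_def lists(3)[symmetric]
    proof (rule gauss_avgs_eq_integral_PiM[OF lipschitz_coords_gauss_avgs[OF lip] lists(4)])
      show "(\<lambda>g. gauss_avgs cs ?M (\<lambda>p. 0 + (\<Sum>k\<in>set js. g k * b k (fst p)))) \<in> borel_measurable (PiM (set js) (\<lambda>_. ?N))"
        unfolding lists(3) eq using U(1) fin(2) by measurable
    qed
    also have "\<dots> = E_gauss_Max J b U + E_gauss_Max K c V"
      unfolding eq unfolding E_gauss_Max_def[of J] using prob_space
      by (subst Bochner_Integration.integral_add) (simp_all add: integrable_gauss_Max[OF U fin(2)])
    finally show ?thesis .
  qed
  ultimately show ?thesis by simp
qed

subsection \<open>Variance of Lipschitz functions\<close>

text \<open>The variance is at most the mean square deviation from \<open>h 0\<close>, and that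
  deviation is at most \<open>K * \<bar>x\<bar>\<close>. Second moments are stated instead of
  variances because they can be integrated out coordinate by coordinate.\<close>

lemma integral_std_normal_square_le:
  fixes h :: "real \<Rightarrow> real"
  assumes h: "\<And>x y. \<bar>h x - h y\<bar> \<le> K * \<bar>x - y\<bar>"
  shows "integrable std_normal_distribution (\<lambda>x. (h x)\<^sup>2)"
    and "(\<integral>x. (h x)\<^sup>2 \<partial>std_normal_distribution) \<le> (\<integral>x. h x \<partial>std_normal_distribution)\<^sup>2 + K\<^sup>2"
proof -
  let ?N = std_normal_distribution
  have int: "integrable ?N h" by (rule integrable_std_normal_lipschitz[OF h])
  have bnd: "(h x - h 0)\<^sup>2 \<le> K\<^sup>2 * x\<^sup>2" for x
    using power_mono[OF h[of x 0], of 2] by (simp add: power_mult_distrib)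
  have "norm ((h x - h 0)\<^sup>2) \<le> norm (K\<^sup>2 * x\<^sup>2)" for x
    using bnd[of x] by simp
  moreover have "(\<lambda>x. (h x - h 0)\<^sup>2) \<in> borel_measurable ?N"
    using borel_measurable_integrable[OF int] by measurable
  moreover have "integrable ?N (\<lambda>x. K\<^sup>2 * x\<^sup>2)" by simp
  ultimately have int2: "integrable ?N (\<lambda>x. (h x - h 0)\<^sup>2)"
    using Bochner_Integration.integrable_bound[OF _ _ AE_I2] by blast
  have eq: "(\<lambda>x. (h x)\<^sup>2) = (\<lambda>x. (h x - h 0)\<^sup>2 + (2 * h 0 * h x - (h 0)\<^sup>2))"
    by (simp add: fun_eq_iff power2_eq_square algebra_simps)
  show "integrable ?N (\<lambda>x. (h x)\<^sup>2)"
    unfolding eq using int int2 by auto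
  have "(\<integral>x. (h x)\<^sup>2 \<partial>?N) = (\<integral>x. (h x - h 0)\<^sup>2 \<partial>?N) + (2 * h 0 * (\<integral>x. h x \<partial>?N) - (h 0)\<^sup>2)"
    unfolding eq using int int2 by (simp add: Bochner_Integration.integral_add)
  also have "(\<integral>x. (h x - h 0)\<^sup>2 \<partial>?N) \<le> (\<integral>x. K\<^sup>2 * x\<^sup>2 \<partial>?N)"
    using bnd int2 by (intro integral_mono) auto
  also have "(\<integral>x. K\<^sup>2 * x\<^sup>2 \<partial>?N) = K\<^sup>2" by simp
  also have "2 * h 0 * (\<integral>x. h x \<partial>?N) - (h 0)\<^sup>2 \<le> (\<integral>x. h x \<partial>?N)\<^sup>2"
    using zero_le_power2[of "(\<integral>x. h x \<partial>?N) - h 0"] by (simp add: power2_eq_square algebra_simps)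
  finally show "(\<integral>x. (h x)\<^sup>2 \<partial>?N) \<le> (\<integral>x. h x \<partial>?N)\<^sup>2 + K\<^sup>2" by simp
qed

lemma integrable_PiM_lipschitz_square:
  assumes I: "finite I" and meas: "f \<in> borel_measurable (PiM I (\<lambda>_. std_normal_distribution))"
    and f: "lipschitz_coords I c f"
  shows "integrable (PiM I (\<lambda>_. std_normal_distribution)) (\<lambda>g. (f g)\<^sup>2)"
proof -
  let ?P = "PiM I (\<lambda>_. std_normal_distribution)"
  interpret prob_space ?P by (rule prob_space_PiM_std_normal)
  have "(f g)\<^sup>2 \<le> 2 * (f (\<lambda>_. 0))\<^sup>2 + 2 * (real (card I) * (\<Sum>k\<in>I. (c k)\<^sup>2 * (g k)\<^sup>2))" for g
  proof -
    have "(f g)\<^sup>2 \<le> (\<bar>f (\<lambda>_. 0)\<bar> + (\<Sum>k\<in>I. c k * \<bar>g k\<bar>))\<^sup>2"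
      using power_mono[OF lipschitz_coords_bound[OF f, of g], of 2] by simp
    also have "\<dots> \<le> 2 * (f (\<lambda>_. 0))\<^sup>2 + 2 * (\<Sum>k\<in>I. c k * \<bar>g k\<bar>)\<^sup>2"
      using zero_le_power2[of "\<bar>f (\<lambda>_. 0)\<bar> - (\<Sum>k\<in>I. c k * \<bar>g k\<bar>)"]
      by (simp add: power2_eq_square algebra_simps)
    also have "(\<Sum>k\<in>I. c k * \<bar>g k\<bar>)\<^sup>2 \<le> (\<Sum>k\<in>I. (c k * \<bar>g k\<bar>)\<^sup>2) * real (card I)"
      by (rule sum_squared_le_sum_of_squares)
    finally show ?thesis by (simp add: power_mult_distrib mult.commute)
  qed
  then have "norm ((f g)\<^sup>2) \<le> norm (2 * (f (\<lambda>_. 0))\<^sup>2 + 2 * (real (card I) * (\<Sum>k\<in>I. (c k)\<^sup>2 * (g k)\<^sup>2)))" for g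
    unfolding real_norm_def abs_power2 by (rule order_trans[OF _ abs_ge_self])
  moreover have "integrable ?P (\<lambda>g. 2 * (f (\<lambda>_. 0))\<^sup>2 + 2 * (real (card I) * (\<Sum>k\<in>I. (c k)\<^sup>2 * (g k)\<^sup>2)))"
  proof -
    have "integrable ?P (\<lambda>g. (g k)\<^sup>2)" if "k \<in> I" for k
      using integrable_PiM_std_normal_component(1)[OF that integrable_std_normal_power] .
    then show ?thesis
      by (intro Bochner_Integration.integrable_add Bochner_Integration.integrable_sum integrable_mult_right) simp_all
  qed
  moreover have "(\<lambda>g. (f g)\<^sup>2) \<in> borel_measurable ?P" using meas by measurable
  ultimately show ?thesis
    using Bochner_Integration.integrable_bound[OF _ _ AE_I2] by blast
qed

text \<open>Efron--Stein: the second moment splits off one coordinate at a time, and each coordinate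
  contributes at most the variance of \<open>c k * x\<close>.\<close>

lemma second_moment_PiM_lipschitz:
  assumes "finite I" "f \<in> borel_measurable (PiM I (\<lambda>_. std_normal_distribution))" "lipschitz_coords I c f"
  shows "(\<integral>g. (f g)\<^sup>2 \<partial>PiM I (\<lambda>_. std_normal_distribution))
    \<le> (\<integral>g. f g \<partial>PiM I (\<lambda>_. std_normal_distribution))\<^sup>2 + (\<Sum>k\<in>I. (c k)\<^sup>2)"
  using assms
proof (induction I arbitrary: f)
  case empty
  interpret prob_space "PiM {} (\<lambda>_::'a. std_normal_distribution)" by (rule prob_space_PiM_std_normal)
  have "f g = f (\<lambda>_. 0)" for g
    using lipschitz_coordsD[OF empty(2), of g "\<lambda>_. 0"] by simp
  then have "f = (\<lambda>_. f (\<lambda>_. 0))" by blast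
  then obtain v where "f = (\<lambda>_. v)" by blast
  then show ?case by (simp add: prob_space)
next
  case (insert k I)
  let ?N = std_normal_distribution
  let ?P = "PiM I (\<lambda>_. ?N)"
  interpret prob_space ?P by (rule prob_space_PiM_std_normal)
  \<comment> \<open>Integrating out the coordinate \<open>k\<close> keeps the Lipschitz constants of
    all others, so the induction hypothesis applies to \<open>fb\<close>.\<close>
  define fb where "fb g = (\<integral>x. f (g(k := x)) \<partial>?N)" for g
  have k: "k \<notin> I" by fact
  have meas2: "(\<lambda>(g, x). f (g(k := x))) \<in> borel_measurable (?P \<Otimes>\<^sub>M ?N)"
    using measurable_compose[OF measurable_add_dim insert.prems(1)] by (simp only: case_prod_unfold)
  have meas: "fb \<in> borel_measurable ?P"
    unfolding fb_def[abs_def] by (rule std_normal.borel_measurable_lebesgue_integral[OF meas2])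
  have line: "\<bar>f (g(k := x)) - f (g(k := y))\<bar> \<le> c k * \<bar>x - y\<bar>" for g x y
  proof -
    have "\<bar>f (g(k := x)) - f (g(k := y))\<bar> \<le> (\<Sum>j\<in>insert k I. c j * \<bar>(g(k := x)) j - (g(k := y)) j\<bar>)"
      by (rule lipschitz_coordsD[OF insert.prems(2)])
    also have "\<dots> = (\<Sum>j\<in>insert k I. if j = k then c k * \<bar>x - y\<bar> else 0)"
      by (intro sum.cong) auto
    also have "\<dots> = c k * \<bar>x - y\<bar>"
      using insert.hyps by (subst sum.delta) auto
    finally show ?thesis .
  qed
  have int_line: "integrable ?N (\<lambda>x. f (g(k := x)))" for g
    by (rule integrable_std_normal_lipschitz[OF line])
  have lip: "lipschitz_coords I c fb"
    unfolding lipschitz_coords_def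
  proof (intro allI)
    fix g h
    have ptw: "\<bar>f (g(k := x)) - f (h(k := x))\<bar> \<le> (\<Sum>j\<in>I. c j * \<bar>g j - h j\<bar>)" for x
    proof -
      have "\<bar>f (g(k := x)) - f (h(k := x))\<bar> \<le> (\<Sum>j\<in>insert k I. c j * \<bar>(g(k := x)) j - (h(k := x)) j\<bar>)"
        by (rule lipschitz_coordsD[OF insert.prems(2)])
      also have "\<dots> = (\<Sum>j\<in>I. c j * \<bar>(g(k := x)) j - (h(k := x)) j\<bar>)"
        using insert.hyps by (subst sum.insert) auto
      also have "\<dots> = (\<Sum>j\<in>I. c j * \<bar>g j - h j\<bar>)"
        using k by (intro sum.cong) auto
      finally show ?thesis .
    qed
    have "\<bar>fb g - fb h\<bar> = \<bar>\<integral>x. f (g(k := x)) - f (h(k := x)) \<partial>?N\<bar>"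
      unfolding fb_def by (subst Bochner_Integration.integral_diff) (simp_all add: int_line)
    also have "\<dots> \<le> (\<integral>x. \<bar>f (g(k := x)) - f (h(k := x))\<bar> \<partial>?N)"
      by (rule integral_abs_bound)
    also have "\<dots> \<le> (\<integral>x. (\<Sum>j\<in>I. c j * \<bar>g j - h j\<bar>) \<partial>?N)"
      using ptw by (intro integral_mono integrable_abs Bochner_Integration.integrable_diff int_line) simp_all
    finally show "\<bar>fb g - fb h\<bar> \<le> (\<Sum>j\<in>I. c j * \<bar>g j - h j\<bar>)" by simp
  qed
  have int_fb2: "integrable ?P (\<lambda>g. (fb g)\<^sup>2)"
    by (rule integrable_PiM_lipschitz_square[OF insert.hyps(1) meas lip])
  have inner: "(\<integral>x. (f (g(k := x)))\<^sup>2 \<partial>?N) \<le> (fb g)\<^sup>2 + (c k)\<^sup>2" for g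
    unfolding fb_def by (rule integral_std_normal_square_le(2)[OF line])
  have "(\<integral>g. (f g)\<^sup>2 \<partial>PiM (insert k I) (\<lambda>_. ?N)) = (\<integral>g. \<integral>x. (f (g(k := x)))\<^sup>2 \<partial>?N \<partial>?P)"
    by (rule std_normal_PiM.product_integral_insert[OF insert.hyps
          integrable_PiM_lipschitz_square[OF _ insert.prems]]) (use insert.hyps in simp)
  also have "\<dots> \<le> (\<integral>g. (fb g)\<^sup>2 + (c k)\<^sup>2 \<partial>?P)"
  proof (rule integral_mono)
    show int: "integrable ?P (\<lambda>g. (fb g)\<^sup>2 + (c k)\<^sup>2)" using int_fb2 by simp
    have "(\<lambda>(g, x). (f (g(k := x)))\<^sup>2) \<in> borel_measurable (?P \<Otimes>\<^sub>M ?N)"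
      using borel_measurable_power[OF meas2, of 2] by (simp add: case_prod_unfold)
    then have "(\<lambda>g. \<integral>x. (f (g(k := x)))\<^sup>2 \<partial>?N) \<in> borel_measurable ?P"
      by (rule std_normal.borel_measurable_lebesgue_integral)
    moreover have "norm (\<integral>x. (f (g(k := x)))\<^sup>2 \<partial>?N) \<le> norm ((fb g)\<^sup>2 + (c k)\<^sup>2)" for g
    proof -
      have "(\<integral>x. (f (g(k := x)))\<^sup>2 \<partial>?N) \<ge> 0" by (rule Bochner_Integration.integral_nonneg) simp
      then show ?thesis using inner[of g] by simp
    qed
    ultimately show "integrable ?P (\<lambda>g. \<integral>x. (f (g(k := x)))\<^sup>2 \<partial>?N)"
      using Bochner_Integration.integrable_bound[OF int _ AE_I2] by blast
  qed (rule inner)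
  also have "\<dots> = (\<integral>g. (fb g)\<^sup>2 \<partial>?P) + (c k)\<^sup>2"
    using int_fb2 prob_space by (subst Bochner_Integration.integral_add) auto
  also have "\<dots> \<le> (\<integral>g. fb g \<partial>?P)\<^sup>2 + (\<Sum>j\<in>I. (c j)\<^sup>2) + (c k)\<^sup>2"
    using insert.IH[OF meas lip] by simp
  also have "(\<integral>g. fb g \<partial>?P) = (\<integral>g. f g \<partial>PiM (insert k I) (\<lambda>_. ?N))"
    unfolding fb_def
    by (rule std_normal_PiM.product_integral_insert[symmetric, OF insert.hyps
          integrable_PiM_lipschitz[OF insert.prems]])
  finally show ?case using insert.hyps by (simp add: algebra_simps)
qed

subsection \<open>Bounds on expected maxima\<close>

lemma gauss_Max_scale:
  assumes "finite S" "S \<noteq> {}" "\<beta> \<ge> 0"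
  shows "gauss_Max I (\<lambda>k s. \<beta> * a k s) S g = \<beta> * gauss_Max I a S g"
proof -
  have "(\<Sum>k\<in>I. g k * (\<beta> * a k s)) = \<beta> * (\<Sum>k\<in>I. g k * a k s)" for s
    by (simp add: sum_distrib_left mult.left_commute)
  then show ?thesis
    by (simp add: gauss_Max_def Max_image_mult[OF assms])
qed

lemma E_gauss_Max_scale:
  assumes "finite S" "S \<noteq> {}" "\<beta> \<ge> 0"
  shows "E_gauss_Max I (\<lambda>k s. \<beta> * a k s) S = \<beta> * E_gauss_Max I a S"
  by (simp add: E_gauss_Max_def gauss_Max_scale[OF assms])

text \<open>The two index sets may have different types; this allows pairs of sign vectors to be
  compared with sign vectors of the joint dimension.\<close>

lemma E_gauss_Max_mono:
  assumes "finite S" "S \<noteq> {}" "finite T" "T \<noteq> {}" "finite I"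
    and "\<And>s. s \<in> S \<Longrightarrow> \<exists>t\<in>T. \<forall>k\<in>I. a k s = b k t"
  shows "E_gauss_Max I a S \<le> E_gauss_Max I b T"
  unfolding E_gauss_Max_def
proof (rule integral_mono[OF integrable_gauss_Max[OF assms(1,2,5)] integrable_gauss_Max[OF assms(3,4,5)]])
  fix g
  have "(\<Sum>k\<in>I. g k * a k s) \<le> Max ((\<lambda>t. \<Sum>k\<in>I. g k * b k t) ` T)" if s: "s \<in> S" for s
  proof -
    obtain t where t: "t \<in> T" "\<forall>k\<in>I. a k s = b k t" using assms(6)[OF s] by blast
    then have "(\<Sum>k\<in>I. g k * a k s) = (\<Sum>k\<in>I. g k * b k t)" by (intro sum.cong) auto
    also have "\<dots> \<le> Max ((\<lambda>t. \<Sum>k\<in>I. g k * b k t) ` T)" using assms(3) t(1) by simp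
    finally show ?thesis .
  qed
  then show "gauss_Max I a S g \<le> gauss_Max I b T g"
    using assms(1,2) by (simp add: gauss_Max_def)
qed

text \<open>Any single member of the process is centred and lies below the maximum.\<close>

lemma E_gauss_Max_nonneg:
  assumes "finite S" "S \<noteq> {}" "finite I"
  shows "E_gauss_Max I a S \<ge> 0"
proof -
  let ?P = "PiM I (\<lambda>_. std_normal_distribution)"
  obtain s where s: "s \<in> S" using assms by auto
  have int: "integrable ?P (\<lambda>g. g k)" and zero: "(\<integral>g. g k \<partial>?P) = 0" if "k \<in> I" for k
    using integrable_PiM_std_normal_component[OF that integrable_std_normal_id] by simp_all
  have "0 = (\<Sum>k\<in>I. (\<integral>g. g k \<partial>?P) * a k s)" by (simp add: zero)
  also have "\<dots> = (\<integral>g. (\<Sum>k\<in>I. g k * a k s) \<partial>?P)"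
    using int by (simp add: Bochner_Integration.integral_sum)
  also have "\<dots> \<le> E_gauss_Max I a S"
    unfolding E_gauss_Max_def using int assms s
    by (intro integral_mono integrable_gauss_Max Bochner_Integration.integrable_sum integrable_mult_left)
       (auto simp: gauss_Max_def)
  finally show ?thesis .
qed

lemma integral_std_normal_exp:
  "integrable std_normal_distribution (\<lambda>x. exp (c * x))"
  "(\<integral>x. exp (c * x) \<partial>std_normal_distribution) = exp (c\<^sup>2 / 2)"
proof -
  have eq: "std_normal_density x * exp (c * x) = exp (c\<^sup>2 / 2) * normal_density c 1 x" for x
  proof -
    have "exp (- x\<^sup>2 / 2) * exp (c * x) = exp (c\<^sup>2 / 2) * exp (- (x - c)\<^sup>2 / 2)"
      unfolding exp_add[symmetric] by (simp add: power2_eq_square field_simps)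
    then show ?thesis
      by (simp add: std_normal_density_def normal_density_def)
  qed
  show "integrable std_normal_distribution (\<lambda>x. exp (c * x))"
    by (subst integrable_density) (simp_all add: eq)
  show "(\<integral>x. exp (c * x) \<partial>std_normal_distribution) = exp (c\<^sup>2 / 2)"
    by (subst integral_density) (simp_all add: eq)
qed

lemma integral_PiM_std_normal_exp:
  assumes "finite I"
  shows "integrable (PiM I (\<lambda>_. std_normal_distribution)) (\<lambda>g. exp (\<Sum>k\<in>I. g k * c k))"
    and "(\<integral>g. exp (\<Sum>k\<in>I. g k * c k) \<partial>PiM I (\<lambda>_. std_normal_distribution)) = exp ((\<Sum>k\<in>I. (c k)\<^sup>2) / 2)"
proof -
  have eq: "exp (\<Sum>k\<in>I. g k * c k) = (\<Prod>k\<in>I. exp (c k * g k))" for g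
    using assms by (simp add: exp_sum mult.commute)
  show "integrable (PiM I (\<lambda>_. std_normal_distribution)) (\<lambda>g. exp (\<Sum>k\<in>I. g k * c k))"
    unfolding eq
    by (rule std_normal_PiM.product_integrable_prod[OF assms integral_std_normal_exp(1)])
  show "(\<integral>g. exp (\<Sum>k\<in>I. g k * c k) \<partial>PiM I (\<lambda>_. std_normal_distribution)) = exp ((\<Sum>k\<in>I. (c k)\<^sup>2) / 2)"
    unfolding eq
    by (subst std_normal_PiM.product_integral_prod[OF assms integral_std_normal_exp(1)])
       (simp add: integral_std_normal_exp(2) exp_sum[OF assms] sum_divide_distrib)
qed

text \<open>Concavity of the logarithm enters through its tangent at \<open>K = card S * exp (\<beta>\<^sup>2 / 2)\<close>.\<close>

lemma E_gauss_Max_le: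
  assumes S: "finite S" "S \<noteq> {}" and I: "finite I" and \<beta>: "\<beta> > 0"
    and var: "\<And>s. s \<in> S \<Longrightarrow> (\<Sum>k\<in>I. (a k s)\<^sup>2) = 1"
  shows "E_gauss_Max I a S \<le> ln (real (card S)) / \<beta> + \<beta> / 2"
proof -
  let ?P = "PiM I (\<lambda>_. std_normal_distribution)"
  interpret prob_space ?P by (rule prob_space_PiM_std_normal)
  define X where "X g s = (\<Sum>k\<in>I. g k * (\<beta> * a k s))" for g s
  define T where "T g = (\<Sum>s\<in>S. exp (X g s))" for g
  \<comment> \<open>\<open>K\<close> is the mean of \<open>T\<close>, so \<open>T g / K - 1\<close>
    integrates to zero.\<close>
  define K where "K = real (card S) * exp (\<beta>\<^sup>2 / 2)"
  have card: "real (card S) > 0" using S by (simp add: card_gt_0_iff)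
  then have K: "K > 0" by (simp add: K_def)
  have "\<beta> * gauss_Max I a S g \<le> T g / K - 1 + ln K" for g
  proof -
    have T: "T g > 0" unfolding T_def by (rule sum_exp_pos[OF S])
    have "\<beta> * gauss_Max I a S g = Max (X g ` S)"
      using gauss_Max_scale[OF S, of \<beta> I a g] \<beta> by (simp add: gauss_Max_def X_def)
    also have "\<dots> \<le> ln (T g)"
      using Max_le_lse[OF S, of "X g"] by (simp add: lse_def T_def)
    also have "ln (T g) = ln (T g / K) + ln K"
      using T K by (simp add: ln_div)
    also have "ln (T g / K) \<le> T g / K - 1"
      using T K by (intro ln_le_minus_one) simp
    finally show ?thesis by simp
  qed
  moreover have intE: "integrable ?P (\<lambda>g. exp (X g s))" for s
    unfolding X_def by (rule integral_PiM_std_normal_exp(1)[OF I])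
  then have intT: "integrable ?P T" unfolding T_def[abs_def] by (intro Bochner_Integration.integrable_sum)
  ultimately have "(\<integral>g. \<beta> * gauss_Max I a S g \<partial>?P) \<le> (\<integral>g. T g / K - 1 + ln K \<partial>?P)"
    by (intro integral_mono) (auto intro!: integrable_gauss_Max S I)
  also have "\<dots> = (\<integral>g. T g \<partial>?P) / K - 1 + ln K"
    using intT prob_space by (simp add: Bochner_Integration.integral_add Bochner_Integration.integral_diff)
  also have "(\<integral>g. T g \<partial>?P) = (\<Sum>s\<in>S. exp (\<beta>\<^sup>2 / 2))"
  proof -
    have "(\<integral>g. exp (X g s) \<partial>?P) = exp (\<beta>\<^sup>2 / 2)" if "s \<in> S" for s
      using var[OF that] unfolding X_def integral_PiM_std_normal_exp(2)[OF I]
      by (simp add: power_mult_distrib sum_distrib_left[symmetric])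
    then show ?thesis
      unfolding T_def using intE by (subst Bochner_Integration.integral_sum) auto
  qed
  also have "\<dots> = K" by (simp add: K_def)
  also have "K / K - 1 + ln K = ln (real (card S)) + \<beta>\<^sup>2 / 2"
    using K card by (simp add: K_def ln_mult)
  finally have "\<beta> * E_gauss_Max I a S \<le> ln (real (card S)) + \<beta>\<^sup>2 / 2"
    by (simp add: E_gauss_Max_def)
  then have "E_gauss_Max I a S \<le> (ln (real (card S)) + \<beta>\<^sup>2 / 2) / \<beta>"
    using \<beta> by (simp add: pos_le_divide_eq mult.commute)
  then show ?thesis
    using \<beta> by (simp add: add_divide_distrib power2_eq_square)
qed

subsection \<open>The Sherrington--Kirkpatrick ground state\<close>

text \<open>Fekete's lemma. Nonnegativity allows the remainder of \<open>n\<close> modulo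
  \<open>k\<close> to be dropped. The bound of every quotient by \<open>L\<close> is kept because it
  reduces positivity of the limit to a single dimension.\<close>

lemma superadditive_converges:
  fixes h :: "nat \<Rightarrow> real"
  assumes nonneg: "\<And>n. h n \<ge> 0"
    and super: "\<And>m n. m > 0 \<Longrightarrow> n > 0 \<Longrightarrow> h m + h n \<le> h (m + n)"
    and bnd: "\<And>n. n > 0 \<Longrightarrow> h n \<le> C * real n"
  obtains L where "(\<lambda>n. h n / real n) \<longlonglongrightarrow> L" and "\<And>k. k > 0 \<Longrightarrow> h k / real k \<le> L"
proof
  define L where "L = (SUP k\<in>{0<..}. h k / real k)"
  have bdd: "bdd_above ((\<lambda>k. h k / real k) ` {0<..})"
    using bnd by (intro bdd_aboveI2[of _ _ C]) (simp add: divide_le_eq)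
  show upper: "h k / real k \<le> L" if "k > 0" for k
    unfolding L_def using that by (intro cSUP_upper[OF _ bdd]) simp
  have mult: "real q * h k \<le> h (q * k + r)" if "k > 0" for q k r
  proof (induction q)
    case (Suc q)
    show ?case
    proof (cases "q * k + r = 0")
      \<comment> \<open>Here \<open>q\<close> and \<open>r\<close> are both zero: superadditivity
        does not cover the empty block, but both sides are \<open>h k\<close>.\<close>
      case True
      then show ?thesis using that by (cases q) auto
    next
      case False
      then show ?thesis using super[of k "q * k + r"] Suc that by (simp add: algebra_simps)
    qed
  qed (use nonneg in simp)
  \<comment> \<open>Rounding \<open>n / k\<close> down loses less than one block, which costs at
    most \<open>h k / n\<close> after division by \<open>n\<close>.\<close>
  have lower: "h k / real k - h k / real n \<le> h n / real n" if k: "k > 0" and n: "n > 0" for k n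
  proof -
    have "real n / real k \<le> real (n div k) + 1"
    proof -
      have "real n = real (n div k) * real k + real (n mod k)"
        by (metis div_mult_mod_eq of_nat_add of_nat_mult)
      moreover have "real (n mod k) \<le> real k" using k by (simp add: less_imp_le)
      ultimately have "real n \<le> (real (n div k) + 1) * real k" by (simp add: algebra_simps)
      then show ?thesis using k by (simp add: divide_le_eq)
    qed
    then have "(real n / real k - 1) * h k \<le> real (n div k) * h k"
      using nonneg[of k] by (intro mult_right_mono) auto
    also have "\<dots> \<le> h n"
      using mult[OF k, of "n div k" "n mod k"] by simp
    finally have "(real n / real k - 1) * h k / real n \<le> h n / real n"
      by (rule divide_right_mono) simp
    then show ?thesis using n k by (simp add: field_simps)
  qed
  show "(\<lambda>n. h n / real n) \<longlonglongrightarrow> L"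
  proof (rule order_tendstoI)
    fix y assume "y < L"
    then obtain k where k: "k > 0" "y < h k / real k"
      using less_cSUP_iff[OF _ bdd, of y] by (auto simp: L_def)
    have "(\<lambda>n. h k / real k - h k / real n) \<longlonglongrightarrow> h k / real k - 0"
      by (intro tendsto_diff tendsto_const lim_const_over_n)
    then have "eventually (\<lambda>n. y < h k / real k - h k / real n) sequentially"
      using k(2) by (intro order_tendstoD) simp_all
    then show "eventually (\<lambda>n. y < h n / real n) sequentially"
      using eventually_gt_at_top[of 0]
    proof eventually_elim
      case (elim n)
      then show ?case using lower[OF k(1), of n] by simp
    qed
  next
    fix y assume "L < y"
    show "eventually (\<lambda>n. h n / real n < y) sequentially"
      using eventually_gt_at_top[of 0]
    proof eventually_elim
      case (elim n)
      then show ?case using upper[of n] \<open>L < y\<close> by simp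
    qed
  qed
qed

section \<open>Overlaps of sign vectors, and ground states as Gaussian maxima\<close>

definition dot :: "nat \<Rightarrow> (nat \<Rightarrow> real) \<Rightarrow> (nat \<Rightarrow> real) \<Rightarrow> real" where
  "dot n x y = (\<Sum>i<n. x i * y i)"

text \<open>The coefficient of the matrix entry at \<open>k\<close> in the quadratic form.
  \<open>outer\<close> plays the same role for the bilinear form, where \<open>fst p\<close> is
  indexed by columns and \<open>snd p\<close> by rows.\<close>

definition quad :: "nat \<times> nat \<Rightarrow> (nat \<Rightarrow> real) \<Rightarrow> real" where
  "quad k x = x (fst k) * x (snd k)"

definition outer :: "nat \<times> nat \<Rightarrow> (nat \<Rightarrow> real) \<times> (nat \<Rightarrow> real) \<Rightarrow> real" where
  "outer k p = snd p (fst k) * fst p (snd k)"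

lemma sum_outer: "(\<Sum>k\<in>{..<m} \<times> {..<n}. outer k p * outer k q) = dot m (snd p) (snd q) * dot n (fst p) (fst q)"
  unfolding dot_def sum_product sum.cartesian_product by (simp add: case_prod_unfold outer_def mult_ac)

lemma sum_quad: "(\<Sum>k\<in>{..<n} \<times> {..<n}. quad k x * quad k y) = (dot n x y)\<^sup>2"
  using sum_outer[of "(x, x)" "(y, y)" n n] by (simp add: quad_def outer_def power2_eq_square)

lemma sum_quad_scaled:
  "(\<Sum>k\<in>{..<n} \<times> {..<n}. (\<beta> * quad k x) * (\<beta> * quad k y)) = \<beta>\<^sup>2 * (dot n x y)\<^sup>2"
  unfolding sum_quad[symmetric] sum_distrib_left by (simp add: power2_eq_square mult_ac)

lemma finite_sign_vectors [simp]: "finite (sign_vectors n)"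
  unfolding sign_vectors_def by (intro finite_PiE) auto

lemma sign_vectors_nonempty [simp]: "sign_vectors n \<noteq> {}"
  unfolding sign_vectors_def by (simp add: PiE_eq_empty_iff)

lemma card_sign_vectors: "n > 0 \<Longrightarrow> card (sign_vectors n) = 2 ^ n"
  unfolding sign_vectors_def by (subst card_PiE) (auto simp: card_insert_if numeral_2_eq_2)

lemma sign_vectors_abs: "x \<in> sign_vectors n \<Longrightarrow> i < n \<Longrightarrow> \<bar>x i\<bar> = 1 / sqrt (real n)"
  unfolding sign_vectors_def by (drule PiE_mem[of _ _ _ i]) auto

lemma dot_sign_vectors:
  assumes "x \<in> sign_vectors n" "n > 0"
  shows "dot n x x = 1"
proof -
  have "x i * x i = 1 / real n" if "i < n" for i
  proof -
    have "x i * x i = \<bar>x i\<bar> * \<bar>x i\<bar>" by simp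
    also have "\<dots> = 1 / real n"
      unfolding sign_vectors_abs[OF assms(1) that] by simp
    finally show ?thesis .
  qed
  then have "dot n x x = (\<Sum>i<n. 1 / real n)" unfolding dot_def by (intro sum.cong) auto
  then show ?thesis using assms(2) by simp
qed

lemma xi_max_eq_gauss_Max:
  assumes "\<And>i j. i < m \<Longrightarrow> j < n \<Longrightarrow> g (i, j) = A i j"
  shows "xi_max m n A = gauss_Max ({..<m} \<times> {..<n}) outer (sign_vectors n \<times> sign_vectors m) g"
proof -
  have "bilin m n A y x = (\<Sum>k\<in>{..<m} \<times> {..<n}. g k * outer k (x, y))" for x y
    unfolding bilin_def sum.cartesian_product
    by (intro sum.cong) (auto simp: outer_def assms mult_ac)
  then have "{bilin m n A y x |x y. x \<in> sign_vectors n \<and> y \<in> sign_vectors m}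
      = (\<lambda>p. \<Sum>k\<in>{..<m} \<times> {..<n}. g k * outer k p) ` (sign_vectors n \<times> sign_vectors m)"
    by (auto simp: image_iff)
  then show ?thesis by (simp add: xi_max_def gauss_Max_def)
qed

lemma sk_max_eq_gauss_Max:
  "sk_max n (curry g) = gauss_Max ({..<n} \<times> {..<n}) quad (sign_vectors n) g"
proof -
  have "bilin n n (curry g) x x = (\<Sum>k\<in>{..<n} \<times> {..<n}. g k * quad k x)" for x
    unfolding bilin_def sum.cartesian_product
    by (intro sum.cong) (auto simp: quad_def mult_ac)
  then have "{bilin n n (curry g) x x |x. x \<in> sign_vectors n}
      = (\<lambda>x. \<Sum>k\<in>{..<n} \<times> {..<n}. g k * quad k x) ` sign_vectors n"
    by auto
  then show ?thesis by (simp add: sk_max_def gauss_Max_def)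
qed

definition E_sk_max :: "nat \<Rightarrow> real" where
  "E_sk_max n = E_gauss_Max ({..<n} \<times> {..<n}) quad (sign_vectors n)"

definition E_xi_max :: "nat \<Rightarrow> nat \<Rightarrow> real" where
  "E_xi_max m n = E_gauss_Max ({..<m} \<times> {..<n}) outer (sign_vectors n \<times> sign_vectors m)"

lemma xi_SK_eq: "xi_SK = lim (\<lambda>n. E_sk_max n / sqrt (2 * real n))"
  unfolding xi_SK_def E_sk_max_def E_gauss_Max_def gaussian_matrix_measure_def sk_max_eq_gauss_Max ..

lemma E_xi_max_ge:
  assumes "m > 0" "n > 0"
  shows "(E_sk_max n + E_sk_max m) / sqrt 2 \<le> E_xi_max m n"
proof -
  \<comment> \<open>The factor \<open>1 / sqrt 2\<close> equalises the variances: each of the two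
    quadratic forms contributes one half, since sign vectors have norm one.\<close>
  let ?b = "\<lambda>k x. 1 / sqrt 2 * quad k x"
  have sc: "E_gauss_Max ({..<n} \<times> {..<n}) ?b (sign_vectors n) = 1 / sqrt 2 * E_sk_max n" for n
    unfolding E_sk_max_def by (rule E_gauss_Max_scale) auto
  have "E_gauss_Max ({..<n} \<times> {..<n}) ?b (sign_vectors n) + E_gauss_Max ({..<m} \<times> {..<m}) ?b (sign_vectors m)
      \<le> E_gauss_Max ({..<m} \<times> {..<n}) outer (sign_vectors n \<times> sign_vectors m)"
  proof (rule E_gauss_Max_Slepian)
    fix x y x' y'
    have "0 \<le> (dot m y y' - dot n x x')\<^sup>2" by simp
    then show "(\<Sum>k\<in>{..<m} \<times> {..<n}. outer k (x, y) * outer k (x', y'))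
        \<le> (\<Sum>k\<in>{..<n} \<times> {..<n}. ?b k x * ?b k x') + (\<Sum>k\<in>{..<m} \<times> {..<m}. ?b k y * ?b k y')"
      unfolding sum_quad_scaled sum_outer by (simp add: power2_eq_square power_divide algebra_simps)
  next
    fix x y assume "x \<in> sign_vectors n" "y \<in> sign_vectors m"
    then show "(\<Sum>k\<in>{..<m} \<times> {..<n}. (outer k (x, y))\<^sup>2)
        = (\<Sum>k\<in>{..<n} \<times> {..<n}. (?b k x)\<^sup>2) + (\<Sum>k\<in>{..<m} \<times> {..<m}. (?b k y)\<^sup>2)"
      unfolding power2_eq_square sum_quad_scaled[unfolded power2_eq_square] sum_outer
      by (simp add: dot_sign_vectors assms)
  qed auto
  then show ?thesis
    unfolding sc by (simp add: E_xi_max_def add_divide_distrib)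
qed

text \<open>Concatenation with both blocks rescaled to the common entry size
  \<open>1 / sqrt (n + m)\<close>. Overlaps then become convex combinations of the block overlaps
  with weights \<open>n / (n + m)\<close> and \<open>m / (n + m)\<close>. The restriction is there
  because \<open>sign_vectors\<close> contains extensional functions only.\<close>

definition join_vectors :: "nat \<Rightarrow> nat \<Rightarrow> (nat \<Rightarrow> real) \<times> (nat \<Rightarrow> real) \<Rightarrow> nat \<Rightarrow> real" where
  "join_vectors n m p = (\<lambda>i\<in>{..<n + m}. if i < n then sqrt (real n / real (n + m)) * fst p i
      else sqrt (real m / real (n + m)) * snd p (i - n))"

lemma sum_lessThan_add: "sum f {..<n + m} = sum f {..<n} + (\<Sum>j<m. f (n + j :: nat) :: real)"
  by (induction m) (simp_all add: add.assoc)

lemma dot_join_vectors: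
  "dot (n + m) (join_vectors n m p) (join_vectors n m q)
    = (real n * dot n (fst p) (fst q) + real m * dot m (snd p) (snd q)) / real (n + m)"
proof -
  have sq: "(sqrt u * a) * (sqrt u * b) = u * (a * b)" if "u \<ge> 0" for u a b
  proof -
    have "(sqrt u * a) * (sqrt u * b) = (sqrt u * sqrt u) * (a * b)" by (simp only: mult_ac)
    then show ?thesis using that by simp
  qed
  have "dot (n + m) (join_vectors n m p) (join_vectors n m q)
      = (\<Sum>i<n. real n / real (n + m) * (fst p i * fst q i)) + (\<Sum>j<m. real m / real (n + m) * (snd p j * snd q j))"
    unfolding dot_def sum_lessThan_add
    by (intro arg_cong2[where f="(+)"] sum.cong refl) (simp_all add: join_vectors_def sq)
  then show ?thesis
    by (simp add: dot_def sum_distrib_left sum_divide_distrib add_divide_distrib)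
qed

lemma join_vectors_in_sign_vectors:
  assumes "n > 0" "m > 0" "x \<in> sign_vectors n" "y \<in> sign_vectors m"
  shows "join_vectors n m (x, y) \<in> sign_vectors (n + m)"
proof -
  have eq: "sqrt (real k / real (n + m)) * (u / sqrt (real k)) = u / sqrt (real (n + m))" if "k > 0" for k u
    using that by (simp add: real_sqrt_divide)
  show ?thesis
    unfolding sign_vectors_def
  proof (rule PiE_I)
    fix i assume i: "i \<in> {..<n + m}"
    show "join_vectors n m (x, y) i \<in> {- 1 / sqrt (real (n + m)), 1 / sqrt (real (n + m))}"
    proof (cases "i < n")
      case True
      then have "x i = - 1 / sqrt (real n) \<or> x i = 1 / sqrt (real n)"
        using assms(3) by (auto simp: sign_vectors_def PiE_iff)
      moreover have "join_vectors n m (x, y) i = sqrt (real n / real (n + m)) * x i"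
        using i True by (simp add: join_vectors_def)
      ultimately show ?thesis by (metis eq assms(1) insertCI)
    next
      case False
      then have "y (i - n) = - 1 / sqrt (real m) \<or> y (i - n) = 1 / sqrt (real m)"
        using assms(4) i by (auto simp: sign_vectors_def PiE_iff)
      moreover have "join_vectors n m (x, y) i = sqrt (real m / real (n + m)) * y (i - n)"
        using i False by (simp add: join_vectors_def)
      ultimately show ?thesis by (metis eq assms(2) insertCI)
    qed
  qed (auto simp: join_vectors_def)
qed

text \<open>With the weights \<open>sqrt n\<close>, convexity of the square becomes the covariance
  inequality, and variances agree because equality holds at unit overlaps. Joined vectors form only
  part of all sign vectors, which gives the second inequality.\<close>

lemma E_sk_max_superadditive:
  assumes "n > 0" "m > 0"
  shows "sqrt (real n) * E_sk_max n + sqrt (real m) * E_sk_max m \<le> sqrt (real (n + m)) * E_sk_max (n + m)"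
proof -
  let ?N = "real (n + m)"
  let ?b = "\<lambda>n k x. sqrt (real n) * quad k x"
  let ?a = "\<lambda>k p. sqrt ?N * quad k (join_vectors n m p)"
  let ?S = "sign_vectors n \<times> sign_vectors m"
  have sc: "E_gauss_Max ({..<n} \<times> {..<n}) (?b n) (sign_vectors n) = sqrt (real n) * E_sk_max n" for n
    unfolding E_sk_max_def by (rule E_gauss_Max_scale) auto
  have N: "?N > 0" using assms by simp
  have "E_gauss_Max ({..<n} \<times> {..<n}) (?b n) (sign_vectors n) + E_gauss_Max ({..<m} \<times> {..<m}) (?b m) (sign_vectors m)
      \<le> E_gauss_Max ({..<n + m} \<times> {..<n + m}) ?a ?S"
  proof (rule E_gauss_Max_Slepian)
    fix x y x' y'
    let ?P = "dot n x x'" and ?Q = "dot m y y'"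
    \<comment> \<open>This is exactly the difference of the two sides of the next
      inequality.\<close>
    have "0 \<le> real n * real m * (?P - ?Q)\<^sup>2" by simp
    then have "(real n * ?P + real m * ?Q)\<^sup>2 \<le> ?N * (real n * ?P\<^sup>2 + real m * ?Q\<^sup>2)"
      by (simp add: power2_eq_square algebra_simps)
    then have "(real n * ?P + real m * ?Q)\<^sup>2 / ?N \<le> real n * ?P\<^sup>2 + real m * ?Q\<^sup>2"
      using N by (simp add: divide_le_eq mult.commute)
    moreover have "?N * ((real n * ?P + real m * ?Q) / ?N)\<^sup>2 = (real n * ?P + real m * ?Q)\<^sup>2 / ?N"
      using N by (simp add: power2_eq_square)
    ultimately show "(\<Sum>k\<in>{..<n + m} \<times> {..<n + m}. ?a k (x, y) * ?a k (x', y'))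
        \<le> (\<Sum>k\<in>{..<n} \<times> {..<n}. ?b n k x * ?b n k x') + (\<Sum>k\<in>{..<m} \<times> {..<m}. ?b m k y * ?b m k y')"
      unfolding sum_quad_scaled dot_join_vectors by simp
  next
    fix x y assume "x \<in> sign_vectors n" "y \<in> sign_vectors m"
    then show "(\<Sum>k\<in>{..<n + m} \<times> {..<n + m}. (?a k (x, y))\<^sup>2)
        = (\<Sum>k\<in>{..<n} \<times> {..<n}. (?b n k x)\<^sup>2) + (\<Sum>k\<in>{..<m} \<times> {..<m}. (?b m k y)\<^sup>2)"
      using N unfolding power2_eq_square sum_quad_scaled[unfolded power2_eq_square] dot_join_vectors
      by (simp add: dot_sign_vectors assms)
  qed auto
  also have "E_gauss_Max ({..<n + m} \<times> {..<n + m}) ?a ?S \<le> E_gauss_Max ({..<n + m} \<times> {..<n + m}) (?b (n + m)) (sign_vectors (n + m))"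
    using join_vectors_in_sign_vectors[OF assms] by (intro E_gauss_Max_mono) auto
  finally show ?thesis unfolding sc .
qed

lemma E_sk_max_nonneg: "E_sk_max n \<ge> 0"
  unfolding E_sk_max_def by (rule E_gauss_Max_nonneg) auto

text \<open>The entropy \<open>n * ln 2\<close> suggests \<open>\<beta> = sqrt n\<close>, which
  makes both terms of the general bound of order \<open>sqrt n\<close>.\<close>

lemma E_sk_max_le:
  assumes "n > 0"
  shows "E_sk_max n \<le> 2 * sqrt (real n)"
proof -
  have "E_sk_max n \<le> ln (real (card (sign_vectors n))) / sqrt (real n) + sqrt (real n) / 2"
    unfolding E_sk_max_def using assms
    by (intro E_gauss_Max_le) (auto simp: power2_eq_square sum_quad dot_sign_vectors)
  also have "ln (real (card (sign_vectors n))) = real n * ln 2"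
    using assms by (simp add: card_sign_vectors ln_realpow)
  also have "real n * ln 2 / sqrt (real n) = sqrt (real n) * ln 2"
    using real_div_sqrt[of "real n"] by (metis of_nat_0_le_iff times_divide_eq_left)
  also have "\<dots> \<le> sqrt (real n) * 1"
    using ln_2_less_1 by (intro mult_left_mono) auto
  moreover have "sqrt (real n) \<ge> 0" by simp
  ultimately show ?thesis by linarith
qed

text \<open>With \<open>n = 2\<close>, the vectors \<open>(1, x) / sqrt 2\<close> have a process which Slepian's inequality bounds from below
  by \<open>x * g / sqrt 2\<close> plus an independent constant in \<open>x\<close>.\<close>

lemma E_sk_max_2_pos: "E_sk_max 2 > 0"
proof -
  let ?U = "{-1, 1 :: real}"
  \<comment> \<open>The second component is a dummy that supplies a one-point second factor for
    Slepian's inequality. Dimension one would not do: there the quadratic form is the same for both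
    signs and has mean zero.\<close>
  let ?w = "\<lambda>p :: real \<times> nat. \<lambda>i\<in>{..<2 :: nat}. if i = 0 then 1 / sqrt 2 else fst p / sqrt 2"
  let ?b = "\<lambda>(k :: nat) (x :: real). x / sqrt 2"
  let ?c = "\<lambda>(k :: nat) (y :: nat). 1 / sqrt 2"
  have sum2: "{..<2} = {0, Suc 0}" by auto
  have dot: "dot 2 (?w p) (?w q) = (1 + fst p * fst q) / 2" for p q
    by (simp add: dot_def sum2 add_divide_distrib)
  have "gauss_Max {0} ?b ?U g = \<bar>g 0\<bar> / sqrt 2" for g
    by (auto simp: gauss_Max_def max_def abs_if field_simps)
  then have "E_gauss_Max {0 :: nat} ?b ?U = (\<integral>g. \<bar>g 0\<bar> / sqrt 2 \<partial>PiM {0 :: nat} (\<lambda>_. std_normal_distribution))"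
    by (simp add: E_gauss_Max_def)
  also have "\<dots> = sqrt (2 / pi) / sqrt 2"
    using integrable_PiM_std_normal_component(2)[of 0 "{0 :: nat}" "\<lambda>x. \<bar>x\<bar>"] by simp
  finally have "0 < E_gauss_Max {0 :: nat} ?b ?U" by simp
  also have "E_gauss_Max {0 :: nat} ?b ?U \<le> E_gauss_Max {0 :: nat} ?b ?U + E_gauss_Max {0} ?c {0}"
    using E_gauss_Max_nonneg[of "{0 :: nat}" "{0}" ?c] by simp
  \<comment> \<open>The covariances agree:
    \<open>((1 + x * x') / 2)\<^sup>2 = (1 + x * x') / 2\<close> because
    \<open>(x * x')\<^sup>2 = 1\<close>.\<close>
  also have "\<dots> \<le> E_gauss_Max ({..<2} \<times> {..<2}) (\<lambda>k p. quad k (?w p)) (?U \<times> {0})"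
    by (rule E_gauss_Max_Slepian) (auto simp: power2_eq_square sum_quad dot)
  also have "\<dots> \<le> E_sk_max 2"
    unfolding E_sk_max_def
  proof (rule E_gauss_Max_mono)
    fix p assume "p \<in> ?U \<times> {0 :: nat}"
    then have "?w p \<in> sign_vectors 2"
      by (auto simp: sign_vectors_def PiE_iff extensional_def)
    then show "\<exists>t\<in>sign_vectors 2. \<forall>k\<in>{..<2} \<times> {..<2}. quad k (?w p) = quad k t" by blast
  qed auto
  finally show ?thesis .
qed

text \<open>The Fekete limit of \<open>E_sk_max n / sqrt n\<close> is \<open>sqrt 2 * xi_SK\<close>;
  convergence also gives the \<open>lim\<close> in the definition of \<open>xi_SK\<close> its
  meaning. The limit dominates every quotient, in particular the positive one at dimension
  two.\<close>

lemma xi_SK_limit: "(\<lambda>n. E_sk_max n / sqrt (2 * real n)) \<longlonglongrightarrow> xi_SK"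
  and xi_SK_pos: "xi_SK > 0"
proof -
  let ?h = "\<lambda>n. sqrt (real n) * E_sk_max n"
  obtain L where L: "(\<lambda>n. ?h n / real n) \<longlonglongrightarrow> L" and upper: "\<And>k. k > 0 \<Longrightarrow> ?h k / real k \<le> L"
  proof (rule superadditive_converges[of ?h 2])
    show "?h n \<le> 2 * real n" if "n > 0" for n
    proof -
      have "?h n \<le> sqrt (real n) * (2 * sqrt (real n))"
        by (intro mult_left_mono E_sk_max_le that) simp
      also have "\<dots> = 2 * (sqrt (real n) * sqrt (real n))" by (simp only: mult.left_commute)
      finally show ?thesis by simp
    qed
  qed (use E_sk_max_nonneg E_sk_max_superadditive in auto)
  have eq: "?h n / real n / sqrt 2 = E_sk_max n / sqrt (2 * real n)" for n
    by (cases "n = 0") (simp_all add: real_sqrt_mult field_simps)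
  have "(\<lambda>n. E_sk_max n / sqrt (2 * real n)) \<longlonglongrightarrow> L / sqrt 2"
    using tendsto_divide[OF L tendsto_const, of "sqrt 2"] unfolding eq by simp
  moreover from this have "xi_SK = L / sqrt 2"
    unfolding xi_SK_eq by (rule limI)
  moreover have "L > 0"
    using upper[of 2] E_sk_max_2_pos by (smt (verit) divide_pos_pos mult_pos_pos of_nat_0_less_iff real_sqrt_gt_zero zero_less_numeral of_nat_numeral)
  ultimately show "(\<lambda>n. E_sk_max n / sqrt (2 * real n)) \<longlonglongrightarrow> xi_SK" "xi_SK > 0"
    using divide_pos_pos[of L "sqrt 2"] by simp_all
qed

section \<open>Concentration, and transfer to arbitrary i.i.d. matrices\<close>

lemma xi_max_concentration:
  assumes "m > 0" "n > 0" "t > 0"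
  shows "measure (gaussian_matrix_measure m n)
     {g \<in> space (gaussian_matrix_measure m n). t \<le> \<bar>gauss_Max ({..<m} \<times> {..<n}) outer (sign_vectors n \<times> sign_vectors m) g - E_xi_max m n\<bar>}
     \<le> 1 / t\<^sup>2"
proof -
  let ?I = "{..<m} \<times> {..<n}" and ?S = "sign_vectors n \<times> sign_vectors m"
  let ?f = "gauss_Max ?I outer ?S"
  interpret prob_space "gaussian_matrix_measure m n" by (rule prob_space_gaussian_matrix_measure)
  have S: "finite ?S" "?S \<noteq> {}" by auto
  have meas: "?f \<in> borel_measurable (PiM ?I (\<lambda>_. std_normal_distribution))"
    by (rule measurable_gauss_Max(2)) auto
  \<comment> \<open>There are \<open>m * n\<close> coordinates with this constant, so the squares
    add up to one.\<close>
  have lip: "lipschitz_coords ?I (\<lambda>_. 1 / sqrt (real m) * (1 / sqrt (real n))) ?f"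
    by (rule lipschitz_coords_gauss_Max[OF S]) (auto simp: outer_def abs_mult sign_vectors_abs)
  have int: "integrable (gaussian_matrix_measure m n) ?f"
    unfolding gaussian_matrix_measure_def by (rule integrable_gauss_Max[OF S]) simp
  have int2: "integrable (gaussian_matrix_measure m n) (\<lambda>g. (?f g)\<^sup>2)"
    unfolding gaussian_matrix_measure_def by (rule integrable_PiM_lipschitz_square[OF _ meas lip]) simp
  have E: "expectation ?f = E_xi_max m n"
    by (simp add: E_xi_max_def E_gauss_Max_def gaussian_matrix_measure_def)
  have "expectation (\<lambda>g. (?f g)\<^sup>2) \<le> (expectation ?f)\<^sup>2 + 1"
    using second_moment_PiM_lipschitz[OF _ meas lip] assms
    by (simp add: gaussian_matrix_measure_def power_mult_distrib power_divide)
  then have "variance ?f \<le> 1" using int int2 by (simp add: variance_eq)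
  moreover have "prob {g \<in> space (gaussian_matrix_measure m n). t \<le> \<bar>?f g - expectation ?f\<bar>} \<le> variance ?f / t\<^sup>2"
    by (rule Chebyshev_inequality[OF borel_measurable_integrable[OF int] int2 assms(3)])
  ultimately show ?thesis
    unfolding E using divide_right_mono[of "variance ?f" 1 "t\<^sup>2"] by (simp add: E)
qed

text \<open>Transporting the matrix to the canonical product space removes the dependence on the
  sample space, which may change with \<open>n\<close>. Positive dimensions make the index set
  nonempty, as the characterisation of independence by product laws requires.\<close>

lemma distr_iid_std_normal_matrix:
  assumes M: "prob_space M" and iid: "iid_std_normal_matrix M m n H" and pos: "m > 0" "n > 0"
  defines "T \<equiv> \<lambda>\<omega>. \<lambda>p\<in>{..<m} \<times> {..<n}. H \<omega> (fst p) (snd p)"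
  shows "T \<in> measurable M (gaussian_matrix_measure m n)"
    and "distr M (gaussian_matrix_measure m n) T = gaussian_matrix_measure m n"
proof -
  interpret prob_space M by fact
  let ?I = "{..<m} \<times> {..<n}"
  let ?X = "\<lambda>p \<omega>. H \<omega> (fst p) (snd p)"
  have I: "?I \<noteq> {}" using pos by auto
  have ind: "indep_vars (\<lambda>_. borel) ?X ?I"
    using iid by (simp add: iid_std_normal_matrix_def case_prod_unfold)
  have dist: "distributed M lborel (?X p) std_normal_density" if "p \<in> ?I" for p
    using iid that by (auto simp: iid_std_normal_matrix_def)
  have rv: "random_variable borel (?X p)" if "p \<in> ?I" for p
    using distributed_measurable[OF dist[OF that]] by simp
  have sets: "sets (PiM ?I (\<lambda>_. std_normal_distribution)) = sets (PiM ?I (\<lambda>_. borel :: real measure))"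
    by (intro sets_PiM_cong) auto
  have "T \<in> measurable M (PiM ?I (\<lambda>_. borel))"
    unfolding T_def by (intro measurable_restrict rv)
  then show "T \<in> measurable M (gaussian_matrix_measure m n)"
    unfolding gaussian_matrix_measure_def by (simp cong: measurable_cong_sets add: sets)
  have "distr M (gaussian_matrix_measure m n) T = distr M (PiM ?I (\<lambda>_. borel)) T"
    unfolding gaussian_matrix_measure_def by (intro distr_cong sets refl)
  also have "\<dots> = PiM ?I (\<lambda>p. distr M borel (?X p))"
    using indep_vars_iff_distr_eq_PiM'[OF I rv] ind by (simp add: T_def)
  also have "\<dots> = gaussian_matrix_measure m n"
    unfolding gaussian_matrix_measure_def
  proof (intro PiM_cong refl)
    fix p assume "p \<in> ?I"
    have "distr M borel (?X p) = distr M lborel (?X p)" by (intro distr_cong) auto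
    then show "distr M borel (?X p) = std_normal_distribution"
      using dist[OF \<open>p \<in> ?I\<close>] by (simp add: distributed_def)
  qed
  finally show "distr M (gaussian_matrix_measure m n) T = gaussian_matrix_measure m n" .
qed

lemma xi_max_iid:
  assumes M: "prob_space M" and iid: "iid_std_normal_matrix M m n H" and pos: "m > 0" "n > 0"
  shows "(\<lambda>\<omega>. xi_max m n (H \<omega>)) \<in> borel_measurable M"
    and "(\<integral>\<omega>. xi_max m n (H \<omega>) \<partial>M) = E_xi_max m n"
    and "t > 0 \<Longrightarrow> l \<le> E_xi_max m n - t \<Longrightarrow> 1 - 1 / t\<^sup>2 \<le> measure M {\<omega> \<in> space M. l \<le> xi_max m n (H \<omega>)}"
proof -
  interpret prob_space M by fact
  let ?G = "gaussian_matrix_measure m n"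
  let ?f = "gauss_Max ({..<m} \<times> {..<n}) outer (sign_vectors n \<times> sign_vectors m)"
  define T where "T = (\<lambda>\<omega>. \<lambda>p\<in>{..<m} \<times> {..<n}. H \<omega> (fst p) (snd p))"
  note T = distr_iid_std_normal_matrix[OF M iid pos, folded T_def]
  have eq: "xi_max m n (H \<omega>) = ?f (T \<omega>)" for \<omega>
    by (rule xi_max_eq_gauss_Max) (simp add: T_def)
  have meas: "?f \<in> borel_measurable ?G"
    unfolding gaussian_matrix_measure_def by (rule measurable_gauss_Max(2)) auto
  show xm: "(\<lambda>\<omega>. xi_max m n (H \<omega>)) \<in> borel_measurable M"
    unfolding eq by (rule measurable_compose[OF T(1) meas])
  show E: "(\<integral>\<omega>. xi_max m n (H \<omega>) \<partial>M) = E_xi_max m n"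
    unfolding eq integral_distr[OF T(1) meas, symmetric] T(2)
    by (simp add: E_xi_max_def E_gauss_Max_def gaussian_matrix_measure_def)
  assume t: "t > 0" and l: "l \<le> E_xi_max m n - t"
  define D where "D = {g \<in> space ?G. t \<le> \<bar>?f g - E_xi_max m n\<bar>}"
  have D: "D \<in> sets ?G" unfolding D_def using meas by measurable
  have "measure M {\<omega> \<in> space M. t \<le> \<bar>xi_max m n (H \<omega>) - E_xi_max m n\<bar>} = measure M (T -` D \<inter> space M)"
    using measurable_space[OF T(1)] by (intro arg_cong[where f="measure M"]) (auto simp: D_def eq)
  also have "\<dots> = measure ?G D"
    using measure_distr[OF T(1) D] by (simp add: T(2))
  also have "\<dots> \<le> 1 / t\<^sup>2"
    unfolding D_def by (rule xi_max_concentration[OF pos t])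
  finally have "1 - 1 / t\<^sup>2 \<le> 1 - prob {\<omega> \<in> space M. t \<le> \<bar>xi_max m n (H \<omega>) - E_xi_max m n\<bar>}" by simp
  also have "\<dots> = prob {\<omega> \<in> space M. \<not> t \<le> \<bar>xi_max m n (H \<omega>) - E_xi_max m n\<bar>}"
    using xm by (subst prob_neg) auto
  also have "\<dots> \<le> measure M {\<omega> \<in> space M. l \<le> xi_max m n (H \<omega>)}"
    using xm l by (intro finite_measure_mono) auto
  finally show "1 - 1 / t\<^sup>2 \<le> measure M {\<omega> \<in> space M. l \<le> xi_max m n (H \<omega>)}" .
qed

theorem lemma3:
  fixes \<alpha> \<epsilon>\<^sub>m \<epsilon>\<^sub>n :: real
    and m :: "nat \<Rightarrow> nat"
    and M :: "nat \<Rightarrow> 'a measure"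
    and H :: "nat \<Rightarrow> 'a \<Rightarrow> nat \<Rightarrow> nat \<Rightarrow> real"
    and \<xi>\<^sub>l :: "nat \<Rightarrow> real"
  assumes "\<alpha> > 0"
    and "\<And>n. n \<in> admissible \<alpha> \<Longrightarrow> real (m n) = \<alpha> * real n"
    and "\<And>n. n \<in> admissible \<alpha> \<Longrightarrow> prob_space (M n)"
    and "\<And>n. n \<in> admissible \<alpha> \<Longrightarrow> iid_std_normal_matrix (M n) (m n) n (H n)"
    and "0 < \<epsilon>\<^sub>m" "\<epsilon>\<^sub>m < 1" "0 < \<epsilon>\<^sub>n" "\<epsilon>\<^sub>n < 1"
    and "\<And>n. n \<in> admissible \<alpha> \<Longrightarrow>
           \<xi>\<^sub>l n / sqrt (real n) = (1 - \<epsilon>\<^sub>m) * sqrt \<alpha> * xi_SK + (1 - \<epsilon>\<^sub>n) * xi_SK"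
  shows "((\<lambda>n. measure (M n) {\<omega> \<in> space (M n). xi_max (m n) n (H n \<omega>) \<ge> \<xi>\<^sub>l n})
            \<longlongrightarrow> 1) (admissible_at_top \<alpha>)
       \<and> ((\<lambda>n. measure (M n) {\<omega> \<in> space (M n). (xi_max (m n) n (H n \<omega>))\<^sup>2 \<ge> (\<xi>\<^sub>l n)\<^sup>2})
            \<longlongrightarrow> 1) (admissible_at_top \<alpha>)
       \<and> Liminf (admissible_at_top \<alpha>)
            (\<lambda>n. ereal ((\<integral>\<omega>. xi_max (m n) n (H n \<omega>) \<partial>M n) / sqrt (real n)))
          \<ge> ereal ((sqrt \<alpha> + 1) * xi_SK)"
proof -
  let ?F = "admissible_at_top \<alpha>"
  define e where "e n = E_sk_max n / sqrt (2 * real n)" for n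
  \<comment> \<open>Half the gap between \<open>(sqrt \<alpha> + 1) * xi_SK\<close> and the rescaled
    level. One half absorbs the convergence of the means, the other remains as the deviation for
    Chebyshev's inequality.\<close>
  define \<delta> where "\<delta> = (\<epsilon>\<^sub>m * sqrt \<alpha> * xi_SK + \<epsilon>\<^sub>n * xi_SK) / 2"
  note \<alpha> = assms(1)
  have \<delta>: "\<delta> > 0"
    unfolding \<delta>_def using \<alpha> assms(5,7) xi_SK_pos by (intro divide_pos_pos add_pos_pos mult_pos_pos) auto
  have adm: "eventually (\<lambda>n. n \<in> admissible \<alpha>) ?F"
    by (simp add: admissible_at_top_def eventually_inf_principal)
  have seq: "?F \<le> sequentially"
    by (simp add: admissible_at_top_def)
  have pos: "n > 0" "m n > 0" if "n \<in> admissible \<alpha>" for n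
  proof -
    show n: "n > 0" using that by (simp add: admissible_def)
    have "real (m n) > 0" using assms(2)[OF that] \<alpha> n by simp
    then show "m n > 0" by simp
  qed
  \<comment> \<open>\<open>m\<close> is prescribed at admissible \<open>n\<close> only, so its
    divergence is shown along this filter; the limit for \<open>xi_SK\<close> can then be composed
    with \<open>m\<close>.\<close>
  have m_top: "filterlim m sequentially ?F"
    unfolding filterlim_at_top
  proof
    fix Z
    have "eventually (\<lambda>n. real Z / \<alpha> \<le> real n) ?F"
      using filterlim_real_sequentially seq by (auto simp: filterlim_at_top dest: filter_leD)
    with adm show "eventually (\<lambda>n. Z \<le> m n) ?F"
    proof eventually_elim
      case (elim n)
      then have "real Z \<le> real (m n)"
        using \<alpha> by (simp add: assms(2) divide_le_eq mult.commute)
      then show ?case by simp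
    qed
  qed
  have lim: "((\<lambda>n. e n + sqrt \<alpha> * e (m n)) \<longlongrightarrow> xi_SK + sqrt \<alpha> * xi_SK) ?F"
    using tendsto_mono[OF seq xi_SK_limit] filterlim_compose[OF xi_SK_limit m_top]
    unfolding e_def by (intro tendsto_add tendsto_mult tendsto_const)
  have lower: "e n + sqrt \<alpha> * e (m n) \<le> E_xi_max (m n) n / sqrt (real n)" if "n \<in> admissible \<alpha>" for n
  proof -
    have n: "real n > 0" using pos[OF that] by simp
    \<comment> \<open>The factor \<open>sqrt \<alpha>\<close> arises from normalising the energy in
      dimension \<open>m n\<close> by \<open>sqrt n\<close> instead of
      \<open>sqrt (m n)\<close>.\<close>
    have "sqrt \<alpha> / sqrt (2 * real (m n)) = 1 / (sqrt 2 * sqrt (real n))"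
      using \<alpha> n by (simp add: assms(2)[OF that] real_sqrt_mult)
    then have "sqrt \<alpha> * e (m n) = E_sk_max (m n) / (sqrt 2 * sqrt (real n))"
      unfolding e_def by (metis mult.commute mult.right_neutral times_divide_eq_left times_divide_eq_right)
    then have "e n + sqrt \<alpha> * e (m n) = (E_sk_max n + E_sk_max (m n)) / sqrt 2 / sqrt (real n)"
      by (simp add: e_def real_sqrt_mult add_divide_distrib)
    also have "\<dots> \<le> E_xi_max (m n) n / sqrt (real n)"
      using pos[OF that] by (intro divide_right_mono E_xi_max_ge) auto
    finally show ?thesis .
  qed
  have gap: "eventually (\<lambda>n. \<xi>\<^sub>l n \<le> E_xi_max (m n) n - \<delta> * sqrt (real n)) ?F"
  proof -
    have "eventually (\<lambda>n. xi_SK + sqrt \<alpha> * xi_SK - \<delta> < e n + sqrt \<alpha> * e (m n)) ?F"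
      using order_tendstoD(1)[OF lim] \<delta> by simp
    with adm show ?thesis
    proof eventually_elim
      case (elim n)
      have n: "sqrt (real n) > 0" using pos[OF elim(1)] by simp
      have "xi_SK + sqrt \<alpha> * xi_SK - \<delta> = \<xi>\<^sub>l n / sqrt (real n) + \<delta>"
        unfolding assms(9)[OF elim(1)] \<delta>_def by (simp add: field_simps)
      then have "\<xi>\<^sub>l n / sqrt (real n) \<le> E_xi_max (m n) n / sqrt (real n) - \<delta>"
        using elim(2) lower[OF elim(1)] by linarith
      then have "\<xi>\<^sub>l n / sqrt (real n) * sqrt (real n) \<le> (E_xi_max (m n) n / sqrt (real n) - \<delta>) * sqrt (real n)"
        using n by (intro mult_right_mono) auto
      then show ?case using n by (simp add: left_diff_distrib)
    qed
  qed
  have "((\<lambda>n. 1 / \<delta>\<^sup>2 / real n) \<longlongrightarrow> 0) ?F"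
    by (rule tendsto_mono[OF seq lim_const_over_n])
  then have to1: "((\<lambda>n. 1 - 1 / \<delta>\<^sup>2 / real n) \<longlongrightarrow> 1) ?F"
    using tendsto_diff[OF tendsto_const, of _ 0 ?F 1] by simp
  \<comment> \<open>The deviation \<open>\<delta> * sqrt n\<close> against a variance of at most one
    leaves a failure probability of at most \<open>1 / (\<delta>\<^sup>2 * n)\<close>.\<close>
  have prob1: "eventually (\<lambda>n. 1 - 1 / \<delta>\<^sup>2 / real n \<le>
      measure (M n) {\<omega> \<in> space (M n). xi_max (m n) n (H n \<omega>) \<ge> \<xi>\<^sub>l n}) ?F"
    using adm gap
  proof eventually_elim
    case (elim n)
    have "\<delta> * sqrt (real n) > 0" using \<delta> pos[OF elim(1)] by simp
    from xi_max_iid(3)[OF assms(3)[OF elim(1)] assms(4)[OF elim(1)] pos(2)[OF elim(1)] pos(1)[OF elim(1)] this elim(2)]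
    show ?case by (simp add: power_mult_distrib)
  qed
  have prob2: "eventually (\<lambda>n. measure (M n) {\<omega> \<in> space (M n). xi_max (m n) n (H n \<omega>) \<ge> \<xi>\<^sub>l n}
      \<le> measure (M n) {\<omega> \<in> space (M n). (xi_max (m n) n (H n \<omega>))\<^sup>2 \<ge> (\<xi>\<^sub>l n)\<^sup>2}) ?F"
    using adm
  proof eventually_elim
    case (elim n)
    interpret prob_space "M n" by (rule assms(3)[OF elim])
    have [measurable]: "(\<lambda>\<omega>. xi_max (m n) n (H n \<omega>)) \<in> borel_measurable (M n)"
      by (rule xi_max_iid(1)[OF assms(3)[OF elim] assms(4)[OF elim] pos(2)[OF elim] pos(1)[OF elim]])
    \<comment> \<open>Squaring preserves the inequality because the level is nonnegative. This
      inclusion of events suffices, since probabilities are bounded by one.\<close>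
    have "\<xi>\<^sub>l n / sqrt (real n) \<ge> 0"
      unfolding assms(9)[OF elim] using \<alpha> assms(6,8) xi_SK_pos
      by (intro add_nonneg_nonneg mult_nonneg_nonneg) auto
    then have nonneg: "\<xi>\<^sub>l n \<ge> 0"
      using pos[OF elim] by (simp add: zero_le_divide_iff)
    show ?case
      using nonneg by (intro finite_measure_mono) (auto intro: power_mono)
  qed
  have le1: "eventually (\<lambda>n. measure (M n) (A n) \<le> 1) ?F" for A
    using adm by eventually_elim (intro prob_space.prob_le_1 assms(3))
  have "((\<lambda>n. measure (M n) {\<omega> \<in> space (M n). xi_max (m n) n (H n \<omega>) \<ge> \<xi>\<^sub>l n}) \<longlongrightarrow> 1) ?F"
    by (rule tendsto_sandwich[OF prob1 le1 to1 tendsto_const])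
  moreover have "((\<lambda>n. measure (M n) {\<omega> \<in> space (M n). (xi_max (m n) n (H n \<omega>))\<^sup>2 \<ge> (\<xi>\<^sub>l n)\<^sup>2}) \<longlongrightarrow> 1) ?F"
    by (rule tendsto_sandwich[OF prob2 le1 calculation tendsto_const])
  moreover have "ereal ((sqrt \<alpha> + 1) * xi_SK)
      \<le> Liminf ?F (\<lambda>n. ereal ((\<integral>\<omega>. xi_max (m n) n (H n \<omega>) \<partial>M n) / sqrt (real n)))"
    unfolding le_Liminf_iff
  proof (intro allI impI)
    fix y assume y: "y < ereal ((sqrt \<alpha> + 1) * xi_SK)"
    have "((\<lambda>n. ereal (e n + sqrt \<alpha> * e (m n))) \<longlongrightarrow> ereal (xi_SK + sqrt \<alpha> * xi_SK)) ?F"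
      using lim by (rule tendsto_ereal)
    moreover have "y < ereal (xi_SK + sqrt \<alpha> * xi_SK)"
      using y by (simp add: algebra_simps)
    ultimately have "eventually (\<lambda>n. y < ereal (e n + sqrt \<alpha> * e (m n))) ?F"
      by (rule order_tendstoD)
    with adm show "eventually (\<lambda>n. y < ereal ((\<integral>\<omega>. xi_max (m n) n (H n \<omega>) \<partial>M n) / sqrt (real n))) ?F"
    proof eventually_elim
      case (elim n)
      have "(\<integral>\<omega>. xi_max (m n) n (H n \<omega>) \<partial>M n) = E_xi_max (m n) n"
        by (rule xi_max_iid(2)[OF assms(3)[OF elim(1)] assms(4)[OF elim(1)] pos(2)[OF elim(1)] pos(1)[OF elim(1)]])
      then show ?case
        using elim(2) lower[OF elim(1)] by (metis ereal_less_eq(3) less_le_trans)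
    qed
  qed
  ultimately show ?thesis by blast
qed

end
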